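(* (1) Let $k, n$ be two positive integers satisfying $k<n$ and let $p_0,\ldots,p_k\in\mathbb{R}^{1,n}$ be $(k+1)$ points in general position. Then the following hold: (a) The Lorentzian distance-squared mapping $L_{(p_0,\ldots,p_k)}:\mathbb{R}^{1,n}\to\mathbb{R}^{k+1}$ is $\mathcal{A}$-equivalent to the normal form of definite fold mapping $\Phi_k$ if and only if the recognition subspace $V(p_0,\ldots,p_k)$ is time-like. (b) $L_{(p_0,\ldots,p_k)}$ is $\mathcal{A}$-equivalent to the normal form of Lorentzian indefinite fold mapping $\Psi_k$ if and only if $V(p_0,\ldots,p_k)$ is space-like. (c) $L_{(p_0,\ldots,p_k)}$ is $\mathcal{A}$-equivalent to the mapping \[(x_0,\ldots,x_n)\mapsto\left(x_1,\ldots,x_k,\;x_0x_1+\sum_{i=k+1}^n x_i^2\right)\] if and only if $V(p_0,\ldots,p_k)$ is light-like. (2) Let $n$ be a positive integer and let $p_0,\ldots,p_n\in\mathbb{R}^{1,n}$ be $(n+1)$ points in general position. Then the following hold: (a) $L_{(p_0,\ldots,p_n)}:\mathbb{R}^{1,n}\to\mathbb{R}^{n+1}$ is $\mathcal{A}$-equivalent to the normal form of definite fold mapping $\Phi_n$ if and only if $V(p_0,\ldots,p_n)$ is time-like or space-like. (b) $L_{(p_0,\ldots,p_n)}$ is $\mathcal{A}$-equivalent to the mapping $(x_0,\ldots,x_n)\mapsto(x_1,\ldots,x_n,x_0x_1)$ if and only if $V(p_0,\ldots,p_n)$ is light-like. (3) Let $k,n$ be two positive integers satisfying $n<k$ and let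 $p_0,\ldots,p_k\in\mathbb{R}^{1,n}$ be $(k+1)$ points such that the $(n+2)$ points $p_0,\ldots,p_{n+1}$ are in general position. Then $L_{(p_0,\ldots,p_k)}:\mathbb{R}^{1,n}\to\mathbb{R}^{k+1}$ is always $\mathcal{A}$-equivalent to the inclusion $(x_0,\ldots,x_n)\mapsto(x_0,\ldots,x_n,0,\ldots,0)$.
   Context: For a positive integer $n$, $\mathbb{R}^{1,n}$ denotes the vector space $\mathbb{R}^{n+1}$ (coordinates $x=(x_0,x_1,\ldots,x_n)$) equipped with the Lorentzian inner product $\langle x,y\rangle=-x_0y_0+x_1y_1+\cdots+x_ny_n$. A nonzero vector $x\in\mathbb{R}^{1,n}$ is space-like, light-like or time-like if $\langle x,x\rangle>0$, $=0$, $<0$ respectively. A vector subspace $V\subset\mathbb{R}^{1,n}$ is time-like if it contains a time-like vector; space-like if every nonzero vector of $V$ is space-like; light-like otherwise. For $p\in\mathbb{R}^{1,n}$, $\ell_p^2(x)=\langle x-p,x-p\rangle$. For points $p_0,\ldots,p_k\in\mathbb{R}^{1,n}$ ($k\ge1$), the Lorentzian distance-squared mapping is $L_{(p_0,\ldots,p_k)}:\mathbb{R}^{1,n}\to\mathbb{R}^{k+1}$, $L_{(p_0,\ldots,p_k)}(x)=(\ell_{p_0}^2(x),\ldots,\ell_{p_k}^2(x))$. The recognition subspace is $V(p_0,\ldots,p_k)=\sum_{i=1}^k\mathbb{R}\,(p_i-p_0)\subset\mathbb{R}^{1,n}$. The points $p_0,\ldots,p_k$ are in general position if $\dim V(p_0,\ldots,p_k)=k$.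 Two mappings $f,g:\mathbb{R}^{1,n}\to\mathbb{R}^{k+1}$ are $\mathcal{A}$-equivalent if there exist $C^\infty$ diffeomorphisms $h:\mathbb{R}^{1,n}\to\mathbb{R}^{1,n}$ and $H:\mathbb{R}^{k+1}\to\mathbb{R}^{k+1}$ such that $g=H\circ f\circ h$. For $1\le k\le n$, the normal form of definite fold mapping $\Phi_k:\mathbb{R}^{1,n}\to\mathbb{R}^{k+1}$ is $\Phi_k(x_0,\ldots,x_n)=\left(x_1,\ldots,x_k,\;x_0^2+\sum_{i=k+1}^n x_i^2\right)$. For $1\le k<n$, the normal form of Lorentzian indefinite fold mapping $\Psi_k:\mathbb{R}^{1,n}\to\mathbb{R}^{k+1}$ is $\Psi_k(x_0,\ldots,x_n)=\left(x_1,\ldots,x_k,\;-x_0^2+\sum_{i=k+1}^n x_i^2\right)$. *)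

theory Defs
  imports "HOL-Analysis.Analysis"
begin

text \<open>
  Coordinates are numbered from \<open>0\<close>. The index type of \<^typ>\<open>real ^ 'm\<close> is of class
  \<^class>\<open>enum\<close>, and its fixed enumeration supplies the numbering. So \<open>\<real>\<^sup>1\<^sup>,\<^sup>n\<close> is \<^typ>\<open>real ^ 'm\<close>
  with \<open>CARD('m) = n + 1\<close>, and \<open>\<real>\<^sup>k\<^sup>+\<^sup>1\<close> is \<^typ>\<open>real ^ 'l\<close> with \<open>CARD('l) = k + 1\<close>.
\<close>

definition coord :: "real ^ 'm::enum \<Rightarrow> nat \<Rightarrow> real" where
  "coord x i = x $ (enum_class.enum ! i)"

text \<open>The vector with coordinates \<open>f 0, f 1, \<dots>, f (CARD('m) - 1)\<close>.\<close>

definition vec_of :: "(nat \<Rightarrow> real) \<Rightarrow> real ^ 'm::enum" where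
  "vec_of f = (\<chi> j. f (inv_into {..<CARD('m)} ((!) enum_class.enum) j))"

lemma bij_betw_enum_nth:
  "bij_betw ((!) enum_class.enum) {..<CARD('m)} (UNIV :: 'm::enum set)"
  by (rule bij_betw_nth) (simp_all add: enum_distinct enum_UNIV card_UNIV_length_enum)

lemma coord_vec_of:
  assumes "i < CARD('m)"
  shows "coord (vec_of f :: real ^ 'm::enum) i = f i"
  using bij_betw_enum_nth[where 'm='m] assms
  by (simp add: coord_def vec_of_def bij_betw_def)

lemma vec_of_coord: "vec_of (coord x) = (x :: real ^ 'm::enum)"
  using bij_betw_enum_nth[where 'm='m]
  by (simp add: coord_def vec_of_def vec_eq_iff bij_betw_inv_into_right[where A="{..<CARD('m)}"])


definition lorentz :: "real ^ 'm::enum \<Rightarrow> real ^ 'm::enum \<Rightarrow> real" where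
  "lorentz x y = - coord x 0 * coord y 0 + (\<Sum>i = 1..<CARD('m). coord x i * coord y i)"

definition spacelike_vector :: "real ^ 'm::enum \<Rightarrow> bool" where
  "spacelike_vector x \<longleftrightarrow> x \<noteq> 0 \<and> lorentz x x > 0"

definition timelike_vector :: "real ^ 'm::enum \<Rightarrow> bool" where
  "timelike_vector x \<longleftrightarrow> x \<noteq> 0 \<and> lorentz x x < 0"

definition timelike :: "(real ^ 'm::enum) set \<Rightarrow> bool" where
  "timelike V \<longleftrightarrow> (\<exists>x\<in>V. timelike_vector x)"

definition spacelike :: "(real ^ 'm::enum) set \<Rightarrow> bool" where
  "spacelike V \<longleftrightarrow> (\<forall>x\<in>V. x \<noteq> 0 \<longrightarrow> spacelike_vector x)"

definition lightlike :: "(real ^ 'm::enum) set \<Rightarrow> bool" where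
  "lightlike V \<longleftrightarrow> \<not> timelike V \<and> \<not> spacelike V"


definition lorentz_dist_sq :: "real ^ 'm::enum \<Rightarrow> real ^ 'm::enum \<Rightarrow> real" where
  "lorentz_dist_sq p x = lorentz (x - p) (x - p)"

text \<open>Only the points \<open>p 0, \<dots>, p (CARD('l) - 1)\<close> of the family \<open>p\<close> enter this map.\<close>

definition lorentz_dist_sq_map :: "(nat \<Rightarrow> real ^ 'm::enum) \<Rightarrow> real ^ 'm::enum \<Rightarrow> real ^ 'l::enum" where
  "lorentz_dist_sq_map p x = vec_of (\<lambda>j. lorentz_dist_sq (p j) x)"

definition recognition_subspace :: "(nat \<Rightarrow> real ^ 'm::enum) \<Rightarrow> nat \<Rightarrow> (real ^ 'm::enum) set" where
  "recognition_subspace p k = span ((\<lambda>i. p i - p 0) ` {1..k})"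

definition general_position :: "(nat \<Rightarrow> real ^ 'm::enum) \<Rightarrow> nat \<Rightarrow> bool" where
  "general_position p k \<longleftrightarrow> dim (recognition_subspace p k) = k"


text \<open>
  In finite dimensions, \<open>f\<close> is of class \<open>C\<^sup>k\<^sup>+\<^sup>1\<close> iff it is differentiable and its
  derivative in every fixed direction is of class \<open>C\<^sup>k\<close>.
\<close>

primrec Ck :: "nat \<Rightarrow> ('a::euclidean_space \<Rightarrow> 'b::euclidean_space) \<Rightarrow> bool" where
  "Ck 0 f \<longleftrightarrow> continuous_on UNIV f"
| "Ck (Suc k) f \<longleftrightarrow> f differentiable_on UNIV \<and> (\<forall>v. Ck k (\<lambda>x. frechet_derivative f (at x) v))"

definition smooth :: "('a::euclidean_space \<Rightarrow> 'b::euclidean_space) \<Rightarrow> bool" where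
  "smooth f \<longleftrightarrow> (\<forall>k. Ck k f)"

definition diffeomorphism :: "('a::euclidean_space \<Rightarrow> 'b::euclidean_space) \<Rightarrow> bool" where
  "diffeomorphism h \<longleftrightarrow> bij h \<and> smooth h \<and> smooth (inv h)"

definition A_equivalent ::
  "('a::euclidean_space \<Rightarrow> 'b::euclidean_space) \<Rightarrow> ('a \<Rightarrow> 'b) \<Rightarrow> bool" where
  "A_equivalent f g \<longleftrightarrow>
     (\<exists>(h :: 'a \<Rightarrow> 'a) (H :: 'b \<Rightarrow> 'b). diffeomorphism h \<and> diffeomorphism H \<and> g = H \<circ> f \<circ> h)"


text \<open>
  In the normal forms, the last coordinate of the target has number \<open>k\<close>, and the sums
  run over \<open>i = k + 1, \<dots>, n\<close>.
\<close>

definition definite_fold :: "nat \<Rightarrow> real ^ 'm::enum \<Rightarrow> real ^ 'l::enum" where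
  "definite_fold k x = vec_of (\<lambda>j. if j < k then coord x (j + 1)
     else (coord x 0)\<^sup>2 + (\<Sum>i = k+1..<CARD('m). (coord x i)\<^sup>2))"

definition lorentz_indefinite_fold :: "nat \<Rightarrow> real ^ 'm::enum \<Rightarrow> real ^ 'l::enum" where
  "lorentz_indefinite_fold k x = vec_of (\<lambda>j. if j < k then coord x (j + 1)
     else - (coord x 0)\<^sup>2 + (\<Sum>i = k+1..<CARD('m). (coord x i)\<^sup>2))"

end

theory Submission
  imports Defs
begin

text \<open>
  The family \<open>L\<close> is, up to target equivalence, a list of linear forms and one quadratic form:
  the differences \<open>\<ell>\<^sub>i\<^sup>2 - \<ell>\<^sub>0\<^sup>2\<close> are affine in \<open>x\<close>, with linear part \<open>-2 \<langle>x, p\<^sub>i - p\<^sub>0\<rangle>\<close>.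
  Write \<open>Q(x) = \<langle>x, x\<rangle>\<close>, let \<open>V\<close> be the recognition subspace and \<open>W\<close> its Lorentzian orthogonal
  complement, which is the common kernel of those forms. A shear in the target subtracts from \<open>Q\<close>
  any quadratic function of the linear forms, so only the values \<open>\<langle>x, w\<rangle>\<close> of the polar form with
  \<open>w \<in> W\<close> matter.

  For \<open>k \<le> n\<close> the space \<open>W\<close> has dimension \<open>n + 1 - k \<ge> 1\<close>, and it is a line \<open>\<real> e\<close> plus a
  space-like subspace with a Lorentz-orthonormal basis \<open>f\<^sub>i\<close>. If \<open>V\<close> is time-like, \<open>W\<close> is space-like and
  \<open>Q(e) = 1\<close>; if \<open>V\<close> is space-like, \<open>e\<close> can be taken with \<open>Q(e) = -1\<close>. Then \<open>\<langle>x, e\<rangle>\<close>,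
  \<open>\<langle>x, p\<^sub>i - p\<^sub>0\<rangle>\<close> and \<open>\<langle>x, f\<^sub>i\<rangle>\<close> are the coordinates of a fold. If \<open>V\<close> is light-like, \<open>e\<close> is a null
  vector \<open>u\<close> of \<open>V \<inter> W\<close>, normalised by \<open>u\<^sub>0 = 1\<close>; now \<open>\<langle>x, u\<rangle>\<close> is one of the forms coming
  from \<open>V\<close>, and the coordinate complementary to it is \<open>2 x\<^sub>0\<close>. In each case the
  criterion to be checked is that the wanted normal form and \<open>Q\<close> have the same polar form
  against \<open>W\<close> (\<open>A_equivalent_fold_map\<close>). For \<open>n < k\<close> we have \<open>W = 0\<close>, the first \<open>n + 1\<close> forms are
  coordinates, and every other component is subtracted away by the shear (\<open>A_equivalent_inclusion\<close>).

  All diffeomorphisms that occur are affine maps and shears by quadratic maps, whose inverses have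
  the same kind, so smoothness is only ever needed for polynomial maps of degree at most two.

  The converse implications hold because the normal forms are pairwise inequivalent, already for
  bijections in place of diffeomorphisms. The Lorentzian indefinite fold is onto and the other two
  maps are not. For \<open>k < n\<close> the definite fold has a one-point fibre and the light-like normal form
  has none; for \<open>k = n\<close> the fibres of the definite fold have at most two points, while the light-like
  normal form contracts whole lines. As \<open>V\<close> has exactly one of the three types, each equivalence
  determines the type.
\<close>

section \<open>Quadratic maps are smooth\<close>

definition quadratic_map :: "('a::euclidean_space \<Rightarrow> 'b::euclidean_space) \<Rightarrow> bool" where
  "quadratic_map f \<longleftrightarrow> (\<exists>c l b. linear l \<and> bilinear b \<and> f = (\<lambda>x. c + l x + b x x))"

lemma quadratic_mapI:
  assumes "linear l" and "bilinear b" and "\<And>x. f x = c + l x + b x x"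
  shows "quadratic_map f"
  unfolding quadratic_map_def using assms by blast

lemma linear_zero_map: "linear (\<lambda>x. 0)"
  by (rule linearI) auto

lemma bilinear_zero_map: "bilinear (\<lambda>x y. 0)"
  by (simp add: bilinear_def linear_zero_map)

lemma linear_compose_fun: "linear f \<Longrightarrow> linear g \<Longrightarrow> linear (\<lambda>x. g (f x))"
  using linear_compose[of f g] by (simp add: o_def)

lemma quadratic_map_affine:
  assumes "linear l"
  shows "quadratic_map (\<lambda>x. c + l x)"
  by (rule quadratic_mapI[OF assms bilinear_zero_map]) simp

lemma quadratic_map_add:
  assumes "quadratic_map f" and "quadratic_map g"
  shows "quadratic_map (\<lambda>x. f x + g x)"
proof -
  obtain c l b where f: "linear l" "bilinear b" "f = (\<lambda>x. c + l x + b x x)"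
    using assms(1) by (auto simp: quadratic_map_def)
  obtain c' l' b' where g: "linear l'" "bilinear b'" "g = (\<lambda>x. c' + l' x + b' x x)"
    using assms(2) by (auto simp: quadratic_map_def)
  show ?thesis
  proof (rule quadratic_mapI)
    show "linear (\<lambda>x. l x + l' x)"
      using f g by (intro linear_compose_add)
    show "bilinear (\<lambda>x y. b x y + b' x y)"
      using f(2) g(2) by (auto simp: bilinear_def intro: linear_compose_add)
    show "f x + g x = (c + c') + (l x + l' x) + (b x x + b' x x)" for x
      by (simp add: f(3) g(3))
  qed
qed

lemma linear_compose_quadratic_map:
  assumes "linear m" and "quadratic_map f"
  shows "quadratic_map (\<lambda>x. m (f x))"
proof -
  obtain c l b where f: "linear l" "bilinear b" "f = (\<lambda>x. c + l x + b x x)"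
    using assms(2) by (auto simp: quadratic_map_def)
  show ?thesis
  proof (rule quadratic_mapI)
    show "linear (\<lambda>x. m (l x))"
      by (rule linear_compose_fun[OF f(1) assms(1)])
    show "bilinear (\<lambda>x y. m (b x y))"
      using f(2) by (auto simp: bilinear_def intro: linear_compose_fun[OF _ assms(1)])
    show "m (f x) = m c + m (l x) + m (b x x)" for x
      by (simp add: f(3) linear_add[OF assms(1)])
  qed
qed

lemma bilinear_compose_linear:
  assumes "bilinear b" and "linear m"
  shows "bilinear (\<lambda>x y. b (m x) (m y))"
  using assms(1)
  by (auto simp: bilinear_def
      intro: linear_compose_fun[OF assms(2), where g="\<lambda>y. b _ y"]
             linear_compose_fun[OF assms(2), where g="\<lambda>x. b x _"])

lemma quadratic_map_compose_affine:
  assumes "quadratic_map f" and m: "linear m"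
  shows "quadratic_map (\<lambda>x. f (a + m x))"
proof -
  obtain c l b where l: "linear l" and b: "bilinear b" and f: "f = (\<lambda>x. c + l x + b x x)"
    using assms(1) by (auto simp: quadratic_map_def)
  have b1: "linear (\<lambda>y. b x y)" and b2: "linear (\<lambda>x. b x y)" for x y
    using b by (auto simp: bilinear_def)
  show ?thesis
  proof (rule quadratic_mapI)
    show "linear (\<lambda>x. l (m x) + (b a (m x) + b (m x) a))"
      using linear_compose_fun[OF m l] linear_compose_fun[OF m b1[of a]]
        linear_compose_fun[OF m b2[of a]]
      by (intro linear_compose_add)
    show "bilinear (\<lambda>x y. b (m x) (m y))"
      by (rule bilinear_compose_linear[OF b m])
    show "f (a + m x) = (c + l a + b a a) + (l (m x) + (b a (m x) + b (m x) a)) + b (m x) (m x)"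
      for x
      by (simp add: f linear_add[OF l] bilinear_ladd[OF b] bilinear_radd[OF b])
  qed
qed

lemma Ck_const: "Ck k (\<lambda>x. c)"
  by (induction k arbitrary: c) (simp_all)

lemma Ck_affine:
  assumes "linear l"
  shows "Ck k (\<lambda>x. c + l x)"
proof -
  have d: "((\<lambda>x. c + l x) has_derivative l) (at x)" for x
    using assms by (auto intro!: derivative_eq_intros linear_imp_has_derivative)
  have fd: "frechet_derivative (\<lambda>x. c + l x) (at x) = l" for x
    using frechet_derivative_at[OF d] by simp
  show ?thesis
  proof (cases k)
    case 0
    have "continuous_on UNIV (\<lambda>x. c + l x)"
      using has_derivative_continuous[OF d] by (simp add: continuous_on_eq_continuous_at)
    then show ?thesis using 0 by simp
  next
    case (Suc k')
    then show ?thesis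
      using d by (auto simp: fd Ck_const differentiable_on_def differentiable_def
          intro: has_derivative_at_withinI)
  qed
qed

text \<open>
  The directional derivatives of a quadratic map are affine, and those of an affine map are constant.
\<close>

lemma smooth_quadratic_map:
  assumes "quadratic_map f"
  shows "smooth f"
proof -
  obtain c l b where l: "linear l" and b: "bilinear b" and f: "f = (\<lambda>x. c + l x + b x x)"
    using assms by (auto simp: quadratic_map_def)
  have bb: "bounded_bilinear b"
    using b by (simp add: bilinear_conv_bounded_bilinear)
  have d: "(f has_derivative (\<lambda>v. l v + (b x v + b v x))) (at x)" for x
  proof -
    have "((\<lambda>x. b x x) has_derivative (\<lambda>v. b x v + b v x)) (at x)"
      using bounded_bilinear.FDERIV[OF bb has_derivative_ident has_derivative_ident] by simp
    moreover have "((\<lambda>x. c + l x) has_derivative l) (at x)"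
      using l by (auto intro!: derivative_eq_intros linear_imp_has_derivative)
    ultimately show ?thesis
      unfolding f by (auto intro: has_derivative_add)
  qed
  have fd: "(\<lambda>x. frechet_derivative f (at x) v) = (\<lambda>x. l v + (b x v + b v x))" for v
    using frechet_derivative_at[OF d] by metis
  have "linear (\<lambda>x. b x v + b v x)" for v
    using b by (auto simp: bilinear_def intro: linear_compose_add)
  then have Ck: "Ck k (\<lambda>x. frechet_derivative f (at x) v)" for k v
    unfolding fd by (rule Ck_affine)
  have "Ck k f" for k
  proof (cases k)
    case 0
    have "continuous_on UNIV f"
      using has_derivative_continuous[OF d] by (simp add: continuous_on_eq_continuous_at)
    then show ?thesis using 0 by simp
  next
    case (Suc k')
    then show ?thesis
      using d Ck by (auto simp: differentiable_on_def differentiable_def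
          intro: has_derivative_at_withinI)
  qed
  then show ?thesis by (simp add: smooth_def)
qed

section \<open>Equivalences from affine maps and shears\<close>

lemma diffeomorphismI:
  assumes "\<And>x. g (f x) = x" and "\<And>y. f (g y) = y" and "quadratic_map f" and "quadratic_map g"
  shows "diffeomorphism f"
proof -
  have "bij f"
    using assms(1,2) by (intro o_bij[of g]) auto
  moreover have "inv f = g"
    using assms(1,2) by (intro inv_unique_comp) auto
  ultimately show ?thesis
    using assms(3,4) by (simp add: diffeomorphism_def smooth_quadratic_map)
qed

text \<open>
  The shape shared by all equivalences below: affine coordinates \<open>G\<close> on the source and \<open>B\<close> on the
  target, followed by the shear \<open>y \<mapsto> y + F y\<close>. The condition on \<open>F\<close> says that \<open>F\<close> does not see the
  directions in which it moves points; hence \<open>y \<mapsto> y - F y\<close> is the inverse of the shear.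
\<close>

lemma A_equivalent_shearI:
  fixes f g :: "'a::euclidean_space \<Rightarrow> 'b::euclidean_space"
  assumes G: "linear G" "bij G" and B: "linear B" "bij B"
    and F: "quadratic_map F" and shear: "\<And>y y'. F (y + F y') = F y"
    and eq: "\<And>x. g (G x) = B (f (a + x) - c) + F (B (f (a + x) - c))"
  shows "A_equivalent f g"
proof -
  have shear': "F (y - F y') = F y" for y y'
    using shear[of "y - F y'" y'] by simp
  have G': "linear (inv G)"
    using G by (simp add: inj_linear_imp_inv_linear bij_is_inj)
  have B': "linear (inv B)"
    using B by (simp add: inj_linear_imp_inv_linear bij_is_inj)
  have GG: "inv G (G x) = x" "G (inv G x) = x" for x
    using G(2) by (simp_all add: bij_is_inj bij_is_surj surj_f_inv_f)
  have BB: "inv B (B x) = x" "B (inv B x) = x" for x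
    using B(2) by (simp_all add: bij_is_inj bij_is_surj surj_f_inv_f)
  have id: "quadratic_map (\<lambda>x::'b. x)"
    using quadratic_map_affine[OF linear_ident, of "0::'b"] by simp
  let ?h = "\<lambda>y. a + inv G y"
  let ?S = "\<lambda>y. y + F y"
  let ?T = "\<lambda>y. y - F y"
  let ?H = "\<lambda>z. ?S (B (z - c))"
  let ?H' = "\<lambda>w. c + inv B (?T w)"
  have T: "quadratic_map ?T"
    using quadratic_map_add[OF id linear_compose_quadratic_map[OF linear_uminus F]] by simp
  have "diffeomorphism ?h"
  proof (rule diffeomorphismI[where g="\<lambda>x. - G a + G x"])
    show "quadratic_map ?h" by (rule quadratic_map_affine[OF G'])
    show "quadratic_map (\<lambda>x. - G a + G x)" by (rule quadratic_map_affine[OF G(1)])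
  next
    fix y
    show "- G a + G (?h y) = y"
      by (simp add: linear_add[OF G(1)] GG)
    show "a + inv G (- G a + G y) = y"
      by (simp add: linear_diff[OF G'] GG)
  qed
  moreover have "diffeomorphism ?H"
  proof (rule diffeomorphismI[where g="?H'"])
    have "quadratic_map (\<lambda>z. ?S (- B c + B z))"
      by (rule quadratic_map_compose_affine[OF quadratic_map_add[OF id F] B(1)])
    then show "quadratic_map ?H"
      by (simp add: linear_diff[OF B(1)])
    have "quadratic_map (\<lambda>w. (c + 0) + inv B (?T w))"
      using quadratic_map_add[OF quadratic_map_affine[OF linear_zero_map, of c]
          linear_compose_quadratic_map[OF B' T]] by simp
    then show "quadratic_map ?H'"
      by simp
  next
    fix z
    show "?H' (?H z) = z" by (simp add: shear BB)
    show "?H (?H' z) = z" by (simp add: shear' BB)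
  qed
  moreover have "g = ?H \<circ> f \<circ> ?h"
  proof
    fix y
    show "g y = (?H \<circ> f \<circ> ?h) y"
      using eq[of "inv G y"] by (simp add: GG)
  qed
  ultimately show ?thesis
    unfolding A_equivalent_def by blast
qed

section \<open>Coordinates and the Lorentzian form\<close>

lemma vec_eq_coordI:
  fixes x y :: "real ^ 'm::enum"
  assumes "\<And>i. i < CARD('m) \<Longrightarrow> coord x i = coord y i"
  shows "x = y"
proof -
  have "x $ j = y $ j" for j
  proof -
    obtain i where "i < CARD('m)" and "j = enum_class.enum ! i"
      using bij_betw_enum_nth[where 'm='m] by (fastforce simp: bij_betw_def)
    then show ?thesis
      using assms[of i] by (simp add: coord_def)
  qed
  then show ?thesis by (simp add: vec_eq_iff)
qed

lemma coord_simps [simp]: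
  "coord (x + y) i = coord x i + coord y i"
  "coord (x - y) i = coord x i - coord y i"
  "coord (- x) i = - coord x i"
  "coord (r *\<^sub>R x) i = r * coord x i"
  "coord 0 i = 0"
  by (simp_all add: coord_def)

lemma linear_coord: "linear (\<lambda>x. coord x i)"
  by (rule linearI) simp_all

lemma linear_vec_of:
  assumes "\<And>i. i < CARD('m) \<Longrightarrow> linear (\<lambda>x. f x i)"
  shows "linear (\<lambda>x. vec_of (f x) :: real ^ 'm::enum)"
  by (rule linearI; rule vec_eq_coordI)
    (simp_all add: coord_vec_of linear_add[OF assms] linear_scale[OF assms])

lemma bilinear_vec_of:
  assumes "\<And>i. i < CARD('m) \<Longrightarrow> bilinear (\<lambda>x y. f x y i)"
  shows "bilinear (\<lambda>x y. vec_of (f x y) :: real ^ 'm::enum)"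
  using assms by (auto simp: bilinear_def intro: linear_vec_of)

lemma inner_eq_sum_coord:
  fixes x y :: "real ^ 'm::enum"
  shows "inner x y = (\<Sum>i<CARD('m). coord x i * coord y i)"
  using sum.reindex_bij_betw[OF bij_betw_enum_nth[where 'm='m], of "\<lambda>j. x $ j * y $ j"]
  by (simp add: inner_vec_def coord_def)

lemma bilinear_lorentz: "bilinear lorentz"
  unfolding bilinear_def lorentz_def
  by (auto intro!: linearI simp: algebra_simps sum.distrib sum_distrib_left)

lemmas lorentz_simps =
  bilinear_ladd[OF bilinear_lorentz] bilinear_radd[OF bilinear_lorentz]
  bilinear_lmul[OF bilinear_lorentz] bilinear_rmul[OF bilinear_lorentz]
  bilinear_lsub[OF bilinear_lorentz] bilinear_rsub[OF bilinear_lorentz]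
  bilinear_lzero[OF bilinear_lorentz] bilinear_rzero[OF bilinear_lorentz]

lemma linear_lorentz: "linear (\<lambda>x. lorentz x y)" "linear (\<lambda>y. lorentz x y)"
  by (rule bilinear_lorentz[unfolded bilinear_def, THEN conjunct2, THEN spec],
      rule bilinear_lorentz[unfolded bilinear_def, THEN conjunct1, THEN spec])

lemma lorentz_sum_left: "lorentz (sum f A) y = (\<Sum>i\<in>A. lorentz (f i) y)"
  using linear_sum[OF linear_lorentz(1)[of y], of f A] by simp

lemma lorentz_sum_right: "lorentz x (sum f A) = (\<Sum>i\<in>A. lorentz x (f i))"
  using linear_sum[OF linear_lorentz(2)[of x], of f A] by simp

lemma lorentz_commute: "lorentz x y = lorentz y x"
  by (simp add: lorentz_def mult.commute)

lemma lorentz_orthonormal_sum: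
  assumes "finite I" and "j \<in> I"
    and "\<And>i j. i \<in> I \<Longrightarrow> j \<in> I \<Longrightarrow> lorentz (f i) (f j) = (if i = j then 1 else 0)"
  shows "lorentz (\<Sum>i\<in>I. \<gamma> i *\<^sub>R f i) (f j) = \<gamma> j"
proof -
  have "lorentz (\<Sum>i\<in>I. \<gamma> i *\<^sub>R f i) (f j) = (\<Sum>i\<in>I. if i = j then \<gamma> i else 0)"
    unfolding lorentz_sum_left using assms by (intro sum.cong) (auto simp: lorentz_simps)
  then show ?thesis
    using assms by simp
qed

lemma lorentz_pos_if_time_coord_zero:
  fixes x :: "real ^ 'm::enum"
  assumes "coord x 0 = 0" and "x \<noteq> 0"
  shows "lorentz x x > 0"
proof -
  have "lorentz x x = inner x x"
    using assms(1)
    by (simp add: inner_eq_sum_coord lorentz_def lessThan_atLeast0 sum.atLeast_Suc_lessThan)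
  then show ?thesis
    using assms(2) by simp
qed

text \<open>
  The combination \<open>w\<^sub>0 t - t\<^sub>0 w\<close> has vanishing time coordinate, so \<open>Q\<close> is non-negative on it and
  vanishes only if the combination does. By orthogonality its value is \<open>w\<^sub>0\<^sup>2 Q(t) + t\<^sub>0\<^sup>2 Q(w)\<close>, which
  would be \<open>\<le> 0\<close> if \<open>Q(w) \<le> 0\<close>; then \<open>w\<^sub>0 = 0\<close>, and \<open>w\<close> itself has vanishing time coordinate.
\<close>

lemma lorentz_pos_if_perp_timelike:
  fixes t w :: "real ^ 'm::enum"
  assumes t: "lorentz t t < 0" and tw: "lorentz t w = 0" and "w \<noteq> 0"
  shows "lorentz w w > 0"
proof (rule ccontr)
  assume "\<not> lorentz w w > 0"
  then have ww: "lorentz w w \<le> 0" by simp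
  define z where "z = coord w 0 *\<^sub>R t - coord t 0 *\<^sub>R w"
  have zz: "lorentz z z = (coord w 0)\<^sup>2 * lorentz t t + (coord t 0)\<^sup>2 * lorentz w w"
    using tw lorentz_commute[of w t]
    by (simp add: z_def lorentz_simps power2_eq_square algebra_simps)
  have "lorentz z z \<le> 0"
    unfolding zz using t ww by (simp add: mult_nonneg_nonpos add_nonpos_nonpos)
  moreover have "coord z 0 = 0"
    by (simp add: z_def)
  ultimately have "z = 0"
    using lorentz_pos_if_time_coord_zero[of z] by force
  then have "(coord w 0)\<^sup>2 * lorentz t t + (coord t 0)\<^sup>2 * lorentz w w = 0"
    using zz by (simp add: lorentz_simps)
  moreover have "(coord t 0)\<^sup>2 * lorentz w w \<le> 0"
    using ww by (simp add: mult_nonneg_nonpos)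
  ultimately have "(coord w 0)\<^sup>2 * lorentz t t \<ge> 0" by linarith
  then have "coord w 0 = 0"
    using t by (simp add: zero_le_mult_iff)
  then show False
    using lorentz_pos_if_time_coord_zero[of w] \<open>w \<noteq> 0\<close> ww by simp
qed

section \<open>Orthogonal complements and orthonormal bases\<close>

definition lorentz_perp :: "(real ^ 'm::enum) set \<Rightarrow> (real ^ 'm::enum) set" where
  "lorentz_perp V = {x. \<forall>v\<in>V. lorentz x v = 0}"

lemma subspace_lorentz_perp: "subspace (lorentz_perp V)"
  by (auto simp: lorentz_perp_def subspace_def lorentz_simps)

lemma lorentz_perp_span: "lorentz_perp (span S) = lorentz_perp S"
proof -
  have "lorentz x v = 0" if "\<And>s. s \<in> S \<Longrightarrow> lorentz x s = 0" and "v \<in> span S" for x v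
    using that(2) by (induction rule: span_induct_alt) (auto simp: lorentz_simps that(1))
  then show ?thesis
    by (auto simp: lorentz_perp_def intro: span_base)
qed

text \<open>
  Changing the sign of the time coordinate is a linear bijection \<open>J\<close> with \<open>\<langle>x, y\<rangle> = J y \<bullet> x\<close>, so the
  Lorentzian complement of \<open>V\<close> is the Euclidean complement of \<open>J V\<close>.
\<close>

lemma dim_lorentz_perp:
  fixes V :: "(real ^ 'm::enum) set"
  assumes "subspace V"
  shows "dim (lorentz_perp V) + dim V = CARD('m)"
proof -
  define J :: "real ^ 'm::enum \<Rightarrow> real ^ 'm::enum"
    where "J x = vec_of (\<lambda>i. if i = 0 then - coord x i else coord x i)" for x
  have coord_J: "coord (J x) i = (if i = 0 then - coord x i else coord x i)" if "i < CARD('m)" for x i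
    using that by (simp add: J_def coord_vec_of)
  have linJ: "linear J"
    by (rule linearI; rule vec_eq_coordI) (simp_all add: coord_J)
  have injJ: "inj J"
  proof (rule injI)
    fix x y assume "J x = J y"
    then have "coord (J x) i = coord (J y) i" for i by simp
    then show "x = y"
      by (intro vec_eq_coordI) (metis coord_J neg_equal_iff_equal)
  qed
  have lorentz_J: "lorentz x y = inner (J y) x" for x y
    by (simp add: inner_eq_sum_coord lorentz_def coord_J lessThan_atLeast0
        sum.atLeast_Suc_lessThan mult.commute)
  have eq: "lorentz_perp V = {y \<in> UNIV. \<forall>x\<in>J ` V. orthogonal x y}"
    by (auto simp: lorentz_perp_def lorentz_J orthogonal_def)
  have "dim (lorentz_perp V) + dim (J ` V) = dim (UNIV :: (real ^ 'm::enum) set)"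
    unfolding eq
    by (rule dim_subspace_orthogonal_to_vectors)
      (use assms linJ in \<open>auto intro: linear_subspace_image\<close>)
  moreover have "dim (J ` V) = dim V"
    using linJ injJ by (intro dim_image_eq) (auto intro: inj_on_subset)
  ultimately show ?thesis by (simp add: dim_UNIV)
qed

lemma hyperplane_section:
  fixes W :: "'a::euclidean_space set" and \<phi> :: "'a \<Rightarrow> real"
  assumes W: "subspace W" and \<phi>: "linear \<phi>" and e: "e \<in> W" "\<phi> e \<noteq> 0"
  shows "subspace {w \<in> W. \<phi> w = 0}"
    and "dim W = dim {w \<in> W. \<phi> w = 0} + 1"
    and "w \<in> W \<Longrightarrow> w - (\<phi> w / \<phi> e) *\<^sub>R e \<in> {w \<in> W. \<phi> w = 0}"
proof -
  let ?U = "{w \<in> W. \<phi> w = 0}"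
  show U: "subspace ?U"
    using W by (auto simp: subspace_def linear_add[OF \<phi>] linear_scale[OF \<phi>] linear_0[OF \<phi>])
  show dec: "w - (\<phi> w / \<phi> e) *\<^sub>R e \<in> ?U" if "w \<in> W" for w
    using W e that by (auto simp: subspace_diff subspace_scale linear_diff[OF \<phi>] linear_scale[OF \<phi>])
  have "W = span (insert e ?U)"
  proof
    show "W \<subseteq> span (insert e ?U)"
      using dec by (auto simp: span_insert U span_eq_iff[THEN iffD2])
    show "span (insert e ?U) \<subseteq> W"
      using e W by (intro span_minimal) auto
  qed
  moreover have "e \<notin> span ?U"
    using e U by (simp add: span_eq_iff[THEN iffD2])
  ultimately show "dim W = dim ?U + 1"
    by (metis dim_insert dim_span)
qed

text \<open>
  Gram--Schmidt: on a space-like subspace \<open>Q\<close> is positive definite, so a nonzero vector can be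
  normalised and the induction continues in its orthogonal complement.
\<close>

lemma spacelike_orthonormal_basis:
  fixes U :: "(real ^ 'm::enum) set"
  assumes "subspace U" and "spacelike U"
  shows "\<exists>f. (\<forall>i<dim U. f i \<in> U) \<and>
             (\<forall>i<dim U. \<forall>j<dim U. lorentz (f i) (f j) = (if i = j then 1 else 0)) \<and>
             (\<forall>x\<in>U. x = (\<Sum>i<dim U. lorentz x (f i) *\<^sub>R f i))"
  using assms
proof (induction "dim U" arbitrary: U)
  case 0
  then have "U \<subseteq> {0}" by (metis dim_eq_0)
  then show ?case using 0(1)[symmetric] by (intro exI[of _ "\<lambda>_. 0"]) (auto simp del: dim_eq_0)
next
  case (Suc d)
  have "\<not> U \<subseteq> {0}" using Suc.hyps(2) by (metis dim_eq_0 Zero_not_Suc)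
  then obtain u where u: "u \<in> U" "u \<noteq> 0" by auto
  then have uu: "lorentz u u > 0"
    using Suc.prems by (auto simp: spacelike_def spacelike_vector_def)
  define g where "g = (1 / sqrt (lorentz u u)) *\<^sub>R u"
  have g: "g \<in> U"
    unfolding g_def using u Suc.prems by (simp add: subspace_scale)
  have gg: "lorentz g g = 1"
    using uu by (simp add: g_def lorentz_simps)
  define U' where "U' = {w \<in> U. lorentz w g = 0}"
  note cut = hyperplane_section[OF Suc.prems(1) linear_lorentz(1)[of g] g]
  have U': "subspace U'" "dim U = dim U' + 1"
    and dec: "w \<in> U \<Longrightarrow> w - lorentz w g *\<^sub>R g \<in> U'" for w
    using cut(1,2) cut(3)[of w] unfolding U'_def gg by auto
  have "spacelike U'"
    using Suc.prems by (auto simp: spacelike_def U'_def)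
  moreover have d: "d = dim U'" using U' Suc.hyps(2) by simp
  ultimately obtain f where f: "\<And>i. i < d \<Longrightarrow> f i \<in> U'"
    and on: "\<And>i j. i < d \<Longrightarrow> j < d \<Longrightarrow> lorentz (f i) (f j) = (if i = j then 1 else 0)"
    and ex: "\<And>x. x \<in> U' \<Longrightarrow> x = (\<Sum>i<d. lorentz x (f i) *\<^sub>R f i)"
    using Suc.hyps(1)[OF d U'(1)] by blast
  have fg: "lorentz (f i) g = 0" "lorentz g (f i) = 0" if "i < d" for i
    using f[OF that] by (simp_all add: U'_def lorentz_commute)
  define f' where "f' i = (if i < d then f i else g)" for i
  show ?case
    unfolding Suc.hyps(2)[symmetric]
  proof (intro exI[of _ f'] conjI ballI allI impI)
    fix i assume "i < Suc d"
    then show "f' i \<in> U"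
      using f g by (auto simp: f'_def U'_def)
    fix j assume "j < Suc d"
    then show "lorentz (f' i) (f' j) = (if i = j then 1 else 0)"
      using \<open>i < Suc d\<close> by (auto simp: f'_def on fg gg)
  next
    fix x assume "x \<in> U"
    have "x - lorentz x g *\<^sub>R g = (\<Sum>i<d. lorentz (x - lorentz x g *\<^sub>R g) (f i) *\<^sub>R f i)"
      by (rule ex[OF dec[OF \<open>x \<in> U\<close>]])
    also have "\<dots> = (\<Sum>i<d. lorentz x (f i) *\<^sub>R f i)"
      by (intro sum.cong) (simp_all add: lorentz_simps fg)
    finally have "x = (\<Sum>i<d. lorentz x (f i) *\<^sub>R f i) + lorentz x g *\<^sub>R g"
      by (simp add: algebra_simps)
    then show "x = (\<Sum>i<Suc d. lorentz x (f' i) *\<^sub>R f' i)"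
      by (simp add: f'_def)
  qed
qed

text \<open>
  The decomposition of \<open>W\<close> into a line and an orthonormalised space-like hyperplane section. The
  functional \<open>\<phi>\<close> cutting out the section is \<open>\<langle>\<cdot>, e\<rangle>\<close> when \<open>Q(e) \<noteq> 0\<close>; for a null vector \<open>e\<close> that
  functional vanishes on \<open>e\<close>, and the time coordinate serves instead. The indices of \<open>f\<close> are those of
  the squared coordinates in the normal forms.
\<close>

lemma perp_adapted_basis:
  fixes V :: "(real ^ 'm::enum) set" and \<phi> :: "real ^ 'm::enum \<Rightarrow> real"
  assumes V: "subspace V" and \<phi>: "linear \<phi>" and e: "e \<in> lorentz_perp V" "\<phi> e \<noteq> 0"
    and sp: "spacelike {w \<in> lorentz_perp V. \<phi> w = 0}"
  obtains f where
    "\<And>i. i \<in> {dim V + 1..<CARD('m)} \<Longrightarrow> f i \<in> lorentz_perp V"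
    "\<And>i. i \<in> {dim V + 1..<CARD('m)} \<Longrightarrow> \<phi> (f i) = 0"
    "\<And>i j. i \<in> {dim V + 1..<CARD('m)} \<Longrightarrow> j \<in> {dim V + 1..<CARD('m)} \<Longrightarrow>
       lorentz (f i) (f j) = (if i = j then 1 else 0)"
    "\<And>w. w \<in> lorentz_perp V \<Longrightarrow>
       \<exists>\<alpha> \<gamma>. w = \<alpha> *\<^sub>R e + (\<Sum>i = dim V + 1..<CARD('m). \<gamma> i *\<^sub>R f i)"
proof -
  let ?W = "lorentz_perp V"
  define U where "U = {w \<in> ?W. \<phi> w = 0}"
  note cut = hyperplane_section[OF subspace_lorentz_perp \<phi> e]
  have U: "subspace U" "spacelike U"
    using cut(1) sp by (simp_all add: U_def)
  have dimU: "CARD('m) = dim U + (dim V + 1)"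
    using dim_lorentz_perp[OF V] cut(2) by (simp add: U_def)
  obtain g where gU: "\<And>i. i < dim U \<Longrightarrow> g i \<in> U"
    and on: "\<And>i j. i < dim U \<Longrightarrow> j < dim U \<Longrightarrow> lorentz (g i) (g j) = (if i = j then 1 else 0)"
    and ex: "\<And>x. x \<in> U \<Longrightarrow> x = (\<Sum>i<dim U. lorentz x (g i) *\<^sub>R g i)"
    using spacelike_orthonormal_basis[OF U] by blast
  define f where "f i = g (i - (dim V + 1))" for i
  show thesis
  proof (rule that[of f])
    fix i assume i: "i \<in> {dim V + 1..<CARD('m)}"
    then have "f i \<in> U"
      using dimU by (auto simp: f_def intro!: gU)
    then show "f i \<in> ?W" and "\<phi> (f i) = 0"
      by (simp_all add: U_def)
    fix j assume "j \<in> {dim V + 1..<CARD('m)}"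
    then show "lorentz (f i) (f j) = (if i = j then 1 else 0)"
      using i dimU unfolding f_def by (subst on) auto
  next
    fix w assume "w \<in> ?W"
    define x where "x = w - (\<phi> w / \<phi> e) *\<^sub>R e"
    have "x \<in> U"
      using cut(3)[OF \<open>w \<in> ?W\<close>] by (simp add: x_def U_def)
    then have "x = (\<Sum>i = 0..<dim U. lorentz x (g i) *\<^sub>R g i)"
      using ex by (simp add: lessThan_atLeast0)
    also have "\<dots> = (\<Sum>i = 0 + (dim V + 1)..<dim U + (dim V + 1). lorentz x (f i) *\<^sub>R f i)"
      unfolding sum.shift_bounds_nat_ivl by (simp add: f_def)
    finally have "w = (\<phi> w / \<phi> e) *\<^sub>R e + (\<Sum>i = dim V + 1..<CARD('m). lorentz x (f i) *\<^sub>R f i)"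
      using dimU by (simp add: x_def)
    then show "\<exists>\<alpha> \<gamma>. w = \<alpha> *\<^sub>R e + (\<Sum>i = dim V + 1..<CARD('m). \<gamma> i *\<^sub>R f i)"
      by (intro exI)
  qed
qed

lemma spacelike_perp_of_timelike:
  assumes "timelike V"
  shows "spacelike (lorentz_perp V)"
  using assms lorentz_pos_if_perp_timelike
  by (fastforce simp: timelike_def timelike_vector_def spacelike_def spacelike_vector_def
      lorentz_perp_def lorentz_commute)

text \<open>
  Subtract from the unit time vector \<open>t\<close> its orthogonal projection to \<open>V\<close>: the projection has
  non-negative square, so the difference has square at most \<open>Q(t) = -1\<close>.
\<close>

lemma exists_timelike_perp_of_spacelike:
  fixes V :: "(real ^ 'm::enum) set"
  assumes "subspace V" and "spacelike V"
  shows "\<exists>w\<in>lorentz_perp V. lorentz w w < 0"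
proof -
  obtain f where fV: "\<And>i. i < dim V \<Longrightarrow> f i \<in> V"
    and on: "\<And>i j. i < dim V \<Longrightarrow> j < dim V \<Longrightarrow> lorentz (f i) (f j) = (if i = j then 1 else 0)"
    and ex: "\<And>x. x \<in> V \<Longrightarrow> x = (\<Sum>i<dim V. lorentz x (f i) *\<^sub>R f i)"
    using spacelike_orthonormal_basis[OF assms] by blast
  define t :: "real ^ 'm::enum" where "t = vec_of (\<lambda>i. if i = 0 then 1 else 0)"
  have tt: "lorentz t t = -1"
    by (simp add: lorentz_def t_def coord_vec_of)
  define w where "w = t - (\<Sum>i<dim V. lorentz t (f i) *\<^sub>R f i)"
  have wf: "lorentz w (f j) = 0" if "j < dim V" for j
    using lorentz_orthonormal_sum[of "{..<dim V}" j f] that on by (simp add: w_def lorentz_simps)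
  have "lorentz w v = 0" if "v \<in> V" for v
  proof -
    have "lorentz w v = lorentz w (\<Sum>i<dim V. lorentz v (f i) *\<^sub>R f i)"
      using ex[OF that] by (rule arg_cong)
    also have "\<dots> = 0"
      by (simp add: lorentz_sum_right lorentz_simps wf)
    finally show ?thesis .
  qed
  then have "w \<in> lorentz_perp V"
    by (simp add: lorentz_perp_def)
  moreover have "lorentz w w < 0"
  proof -
    have "lorentz w w = lorentz w (t - (\<Sum>i<dim V. lorentz t (f i) *\<^sub>R f i))"
      by (simp add: w_def)
    also have "\<dots> = lorentz w t"
      by (simp add: lorentz_simps lorentz_sum_right wf)
    also have "\<dots> = lorentz t t - (\<Sum>i<dim V. (lorentz t (f i))\<^sup>2)"
      by (simp add: w_def lorentz_simps lorentz_sum_left lorentz_commute[of "f i" t for i]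
          power2_eq_square)
    also have "\<dots> < 0"
      using tt sum_nonneg[of "{..<dim V}" "\<lambda>i. (lorentz t (f i))\<^sup>2"] by simp
    finally show ?thesis .
  qed
  ultimately show ?thesis by blast
qed

text \<open>
  On a light-like \<open>V\<close> the form \<open>Q\<close> is positive semidefinite with a nonzero null vector \<open>u\<close>. If some
  \<open>\<langle>u, v\<rangle>\<close> were nonzero, \<open>Q(v + s u) = Q(v) + 2 s \<langle>u, v\<rangle>\<close> would be negative for a suitable \<open>s\<close>; hence \<open>u\<close>
  is orthogonal to \<open>V\<close>. A null vector with vanishing time coordinate is zero, so \<open>u\<close> can be normalised.
\<close>

lemma exists_null_vector_of_lightlike:
  fixes V :: "(real ^ 'm::enum) set"
  assumes "subspace V" and "lightlike V"
  shows "\<exists>u\<in>V \<inter> lorentz_perp V. coord u 0 = 1"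
proof -
  have nonneg: "lorentz v v \<ge> 0" if "v \<in> V" for v
    using assms(2) that
    by (cases "v = 0") (force simp: lightlike_def timelike_def timelike_vector_def lorentz_simps)+
  obtain u where u: "u \<in> V" "u \<noteq> 0" "\<not> lorentz u u > 0"
    using assms(2) by (auto simp: lightlike_def spacelike_def spacelike_vector_def)
  then have uu: "lorentz u u = 0"
    using nonneg[of u] by simp
  have uv: "lorentz u v = 0" if "v \<in> V" for v
  proof (rule ccontr)
    assume ne: "lorentz u v \<noteq> 0"
    \<comment> \<open>The parameter with \<open>Q(v + s u) = -1\<close>.\<close>
    define s where "s = - (lorentz v v + 1) / (2 * lorentz u v)"
    have "v + s *\<^sub>R u \<in> V"
      using that u(1) assms(1) by (simp add: subspace_add subspace_scale)
    then have "0 \<le> lorentz v v + 2 * s * lorentz u v"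
      using nonneg[of "v + s *\<^sub>R u"] uu lorentz_commute[of v u] by (simp add: lorentz_simps)
    also have "\<dots> = -1"
      using ne by (simp add: s_def field_simps)
    finally show False by simp
  qed
  have u0: "coord u 0 \<noteq> 0"
    using lorentz_pos_if_time_coord_zero[of u] u by blast
  show ?thesis
  proof (intro bexI[of _ "(1 / coord u 0) *\<^sub>R u"])
    show "(1 / coord u 0) *\<^sub>R u \<in> V \<inter> lorentz_perp V"
      using u(1) uv assms(1) by (simp add: subspace_scale lorentz_perp_def lorentz_simps)
  qed (use u0 in simp)
qed

lemma basis_with_first_vector:
  fixes V :: "'a::euclidean_space set"
  assumes "u \<in> V" and "u \<noteq> 0"
  obtains e :: "nat \<Rightarrow> 'a" where "e 1 = u" and "\<And>j. j \<in> {1..dim V} \<Longrightarrow> e j \<in> V"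
    and "V \<subseteq> span (e ` {1..dim V})" and "dim V \<ge> 1"
proof -
  have "independent {u}"
    using assms(2) by simp
  then obtain C where C: "{u} \<subseteq> C" "C \<subseteq> V" "independent C" "V \<subseteq> span C"
    using maximal_independent_subset_extend[of "{u}" V] assms(1) by auto
  have cardC: "card C = dim V" and finC: "finite C"
    using basis_card_eq_dim[OF C(2,4,3)] independent_imp_finite[OF C(3)] by auto
  then have pos: "dim V \<ge> 1"
    using C(1) by (metis card_gt_0_iff empty_iff insert_subset less_one linorder_not_le neq0_conv)
  obtain g where g: "bij_betw g {2..dim V} (C - {u})"
    using finite_same_card_bij[of "{2..dim V}" "C - {u}"] finC C(1) cardC by auto
  define e where "e j = (if j = 1 then u else g j)" for j :: nat
  have "{1..dim V} = insert 1 {2..dim V}"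
    using pos by auto
  moreover have "e ` {2..dim V} = C - {u}"
    using g by (auto simp: bij_betw_def e_def)
  moreover have "e 1 = u"
    by (simp add: e_def)
  ultimately have img: "e ` {1..dim V} = C"
    using C(1) by auto
  show thesis
    by (rule that[of e]) (use img C pos in \<open>auto simp: e_def\<close>)
qed

section \<open>Normal forms from Lorentzian coordinates\<close>

definition fold_map :: "nat \<Rightarrow> (real ^ 'm::enum \<Rightarrow> real) \<Rightarrow> real ^ 'm::enum \<Rightarrow> real ^ 'l::enum" where
  "fold_map k N x = vec_of (\<lambda>j. if j < k then coord x (j + 1) else N x)"

lemma definite_fold_eq_fold_map:
  "(definite_fold k :: real ^ 'm::enum \<Rightarrow> real ^ 'l::enum) =
     fold_map k (\<lambda>x. (coord x 0)\<^sup>2 + (\<Sum>i = k+1..<CARD('m). (coord x i)\<^sup>2))"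
  by (intro ext) (simp only: fold_map_def definite_fold_def)

lemma lorentz_indefinite_fold_eq_fold_map:
  "(lorentz_indefinite_fold k :: real ^ 'm::enum \<Rightarrow> real ^ 'l::enum) =
     fold_map k (\<lambda>x. - (coord x 0)\<^sup>2 + (\<Sum>i = k+1..<CARD('m). (coord x i)\<^sup>2))"
  by (intro ext) (simp only: fold_map_def lorentz_indefinite_fold_def)

definition lorentz_coords :: "(nat \<Rightarrow> real ^ 'm::enum) \<Rightarrow> real ^ 'm::enum \<Rightarrow> real ^ 'm::enum" where
  "lorentz_coords e x = vec_of (\<lambda>i. lorentz x (e i))"

lemma coord_lorentz_coords:
  "i < CARD('m) \<Longrightarrow> coord (lorentz_coords e x :: real ^ 'm::enum) i = lorentz x (e i)"
  by (simp add: lorentz_coords_def coord_vec_of)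

lemma linear_lorentz_coords: "linear (lorentz_coords e)"
  unfolding lorentz_coords_def by (intro linear_vec_of linear_lorentz)

lemma bij_lorentz_coords:
  fixes e :: "nat \<Rightarrow> real ^ 'm::enum"
  assumes "\<And>x. (\<And>i. i < CARD('m) \<Longrightarrow> lorentz x (e i) = 0) \<Longrightarrow> x = 0"
  shows "bij (lorentz_coords e)"
proof -
  have "inj (lorentz_coords e)"
  proof (subst linear_injective_0[OF linear_lorentz_coords], intro allI impI)
    fix x assume "lorentz_coords e x = 0"
    then have "lorentz x (e i) = 0" if "i < CARD('m)" for i
      using coord_lorentz_coords[OF that, of e x] by simp
    then show "x = 0" by (rule assms)
  qed
  then show ?thesis
    using linear_injective_imp_surjective[OF linear_lorentz_coords] by (auto simp: bij_def)
qed

lemma coord_lorentz_dist_sq_map_diff: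
  fixes p :: "nat \<Rightarrow> real ^ 'm::enum"
  assumes "j < CARD('l)"
  shows "coord (lorentz_dist_sq_map p (p 0 + x) - lorentz_dist_sq_map p (p 0) :: real ^ 'l::enum) j
    = lorentz x x - 2 * lorentz x (p j - p 0)"
proof -
  define v where "v = p j - p 0"
  have "coord (lorentz_dist_sq_map p (p 0 + x) - lorentz_dist_sq_map p (p 0) :: real ^ 'l::enum) j
      = lorentz (p 0 + x - p j) (p 0 + x - p j) - lorentz (p 0 - p j) (p 0 - p j)"
    using assms by (simp add: lorentz_dist_sq_map_def coord_vec_of lorentz_dist_sq_def)
  also have "p 0 + x - p j = x - v"
    by (simp add: v_def)
  also have "p 0 - p j = 0 - v"
    by (simp add: v_def)
  also have "lorentz (x - v) (x - v) - lorentz (0 - v) (0 - v) = lorentz x x - 2 * lorentz x v"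
    using lorentz_commute[of v x] unfolding lorentz_simps by simp
  finally show ?thesis
    by (simp add: v_def)
qed

lemma span_image_eq_sum:
  assumes "finite I" and "v \<in> span (f ` I)"
  shows "\<exists>c. v = (\<Sum>i\<in>I. c i *\<^sub>R f i)"
  using assms(2)
proof (induction rule: span_induct_alt)
  case base
  show ?case by (intro exI[of _ "\<lambda>_. 0"]) simp
next
  case (step a x y)
  then obtain c i where y: "y = (\<Sum>i\<in>I. c i *\<^sub>R f i)" and i: "i \<in> I" "x = f i" by auto
  have "(\<Sum>j\<in>I. (if j = i then a else 0) *\<^sub>R f j) = (\<Sum>j\<in>I. if j = i then a *\<^sub>R f j else 0)"
    by (intro sum.cong) auto
  also have "\<dots> = a *\<^sub>R x"
    using i assms(1) by simp
  finally have "a *\<^sub>R x + y = (\<Sum>j\<in>I. (c j + (if j = i then a else 0)) *\<^sub>R f j)"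
    unfolding scaleR_add_left sum.distrib y by simp
  then show ?case
    by (intro exI[of _ "\<lambda>j. c j + (if j = i then a else 0)"])
qed

text \<open>
  The vectors \<open>e\<^sub>i\<close> give linear coordinates \<open>\<langle>x, e\<^sub>i\<rangle>\<close> on the source, those with \<open>1 \<le> i \<le> k\<close> being
  combinations of the linear forms contained in \<open>L\<close>. By \<open>radical\<close>, the quadratic form
  \<open>b(G x, G x) - \<tau> Q(x)\<close>, with \<open>G\<close> the coordinate map, has all common zeros of these \<open>k\<close> forms in the radical of its polar form. It is
  therefore a quadratic function of the \<open>k\<close> forms alone, and a shear of the target absorbs it. The factor
  \<open>\<tau>\<close> makes room for the change of sign that turns \<open>-x\<^sub>0\<^sup>2\<close> into \<open>x\<^sub>0\<^sup>2\<close> when \<open>k = n\<close>.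
\<close>

lemma A_equivalent_fold_map:
  fixes p e :: "nat \<Rightarrow> real ^ 'm::enum"
  assumes cardl: "CARD('l) = k + 1" and k: "k < CARD('m)" and \<tau>: "\<tau> \<noteq> 0"
    and b: "bilinear b" and b_sym: "\<And>x y. b x y = b y x"
    and e_V: "\<And>j. j \<in> {1..k} \<Longrightarrow> e j \<in> recognition_subspace p k"
    and nondeg: "\<And>x. (\<And>i. i < CARD('m) \<Longrightarrow> lorentz x (e i) = 0) \<Longrightarrow> x = 0"
    and radical: "\<And>x w. (\<And>j. j \<in> {1..k} \<Longrightarrow> lorentz w (e j) = 0) \<Longrightarrow>
        b (lorentz_coords e x) (lorentz_coords e w) = \<tau> * lorentz x w"
  shows "A_equivalent (lorentz_dist_sq_map p) (fold_map k (\<lambda>x. b x x) :: real ^ 'm::enum \<Rightarrow> real ^ 'l::enum)"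
proof -
  let ?L = "lorentz_dist_sq_map p :: real ^ 'm::enum \<Rightarrow> real ^ 'l::enum"
  define G where "G = lorentz_coords e"
  have G: "linear G" "bij G"
    unfolding G_def by (rule linear_lorentz_coords, rule bij_lorentz_coords[OF nondeg])
  have G': "linear (inv G)"
    using G by (simp add: inj_linear_imp_inv_linear bij_is_inj)
  have GG: "inv G (G x) = x" "G (inv G x) = x" for x
    using G(2) by (simp_all add: bij_is_inj bij_is_surj surj_f_inv_f)
  have coord_G: "coord (G x) i = lorentz x (e i)" if "i < CARD('m)" for x i
    unfolding G_def by (rule coord_lorentz_coords[OF that])
  have "\<exists>c. e j = (\<Sum>i=1..k. c i *\<^sub>R (p i - p 0))" if "j \<in> {1..k}" for j
    using e_V[OF that] unfolding recognition_subspace_def by (intro span_image_eq_sum) simp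
  then obtain c where c: "\<And>j. j \<in> {1..k} \<Longrightarrow> e j = (\<Sum>i=1..k. c j i *\<^sub>R (p i - p 0))"
    by metis
  \<comment> \<open>\<open>B\<close> is applied to differences \<open>L (p 0 + x) - L (p 0)\<close>, whose coordinates are \<open>Q(x) - 2 \<langle>x, p i - p 0\<rangle>\<close>;
    so it returns the forms \<open>\<langle>x, e 1\<rangle>, \<dots>, \<langle>x, e k\<rangle>\<close> followed by \<open>\<tau> Q(x)\<close>.\<close>
  define B :: "real ^ 'l::enum \<Rightarrow> real ^ 'l::enum" where
    "B z = vec_of (\<lambda>j. if j < k then \<Sum>i=1..k. c (j + 1) i * ((coord z 0 - coord z i) / 2)
                       else \<tau> * coord z 0)" for z
  have linB: "linear B"
    unfolding B_def
    by (intro linear_vec_of linearI)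
      (simp_all add: algebra_simps sum.distrib sum_distrib_left add_divide_distrib diff_divide_distrib
         sum_subtractf)
  have coord_B: "coord (B z) j =
      (if j < k then lorentz x (e (j + 1)) else \<tau> * s)"
    if "j < k + 1" and z: "\<And>i. i \<le> k \<Longrightarrow> coord z i = s - 2 * lorentz x (p i - p 0)" for z x s j
  proof -
    have "(coord z 0 - coord z i) / 2 = lorentz x (p i - p 0)" if "i \<le> k" for i
      using z[OF that] z[of 0] by (simp add: lorentz_simps)
    then have "(\<Sum>i=1..k. c (j + 1) i * ((coord z 0 - coord z i) / 2))
        = (\<Sum>i=1..k. c (j + 1) i * lorentz x (p i - p 0))"
      by (intro sum.cong refl) (simp only: atLeastAtMost_iff)
    moreover have "\<dots> = lorentz x (e (j + 1))" if "j < k"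
      using c[of "j + 1"] that by (simp add: lorentz_sum_right lorentz_simps)
    ultimately have "(\<Sum>i=1..k. c (j + 1) i * ((coord z 0 - coord z i) / 2)) = lorentz x (e (j + 1))"
      if "j < k"
      using that by simp
    then show ?thesis
      using \<open>j < k + 1\<close> z[of 0] by (simp add: B_def coord_vec_of cardl lorentz_simps)
  qed
  \<comment> \<open>Bijectivity of \<open>B\<close> without inverting the coefficient matrix \<open>c\<close>: the source coordinates \<open>G\<close> are onto,
    so the first \<open>k\<close> target coordinates can be prescribed by choosing \<open>x\<close>.\<close>
  have "\<exists>z. w = B z" for w
  proof -
    define x where "x = inv G (vec_of (\<lambda>i. coord w (i - 1)))"
    define z :: "real ^ 'l::enum" where
      "z = vec_of (\<lambda>i. coord w k / \<tau> - 2 * lorentz x (p i - p 0))"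
    have z: "coord z i = coord w k / \<tau> - 2 * lorentz x (p i - p 0)" if "i \<le> k" for i
      using that by (simp add: z_def coord_vec_of cardl less_Suc_eq_le)
    have "lorentz x (e (j + 1)) = coord w j" if "j < k" for j
      using coord_G[of "j + 1" x] that k by (simp add: x_def GG coord_vec_of)
    then have "B z = w"
      using \<tau> by (intro vec_eq_coordI, subst coord_B[OF _ z]) (auto simp: cardl less_Suc_eq)
    then show ?thesis by blast
  qed
  then have "surj B"
    by (simp add: surj_def)
  then have B: "bij B"
    using linear_surjective_imp_injective[OF linB] by (auto simp: bij_def)
  \<comment> \<open>The difference of the two forms depends on the coordinates \<open>1, \<dots>, k\<close> only, so it is evaluated at
    the point \<open>inv G (E y)\<close> with these coordinates, the others being \<open>0\<close>.\<close>
  define E :: "real ^ 'l::enum \<Rightarrow> real ^ 'm::enum" where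
    "E y = vec_of (\<lambda>i. if i \<in> {1..k} then coord y (i - 1) else 0)" for y
  have linE: "linear E"
    unfolding E_def by (intro linear_vec_of linearI) simp_all
  define b' where "b' y y' = b (E y) (E y') - \<tau> * lorentz (inv G (E y)) (inv G (E y'))" for y y'
  have bl: "bilinear (\<lambda>x y. \<tau> * lorentz x y)"
    unfolding bilinear_def by (auto intro!: linearI simp: lorentz_simps algebra_simps)
  have "bilinear b'"
    using bilinear_compose_linear[OF b linE]
      bilinear_compose_linear[OF bl linear_compose_fun[OF linE G']]
    unfolding bilinear_def b'_def by (auto intro!: linear_compose_sub)
  then have "bilinear (\<lambda>y y'. if P then 0 else b' y y')" for P
    by (cases P) (simp_all add: bilinear_zero_map)
  then have bil: "bilinear (\<lambda>y y'. vec_of (\<lambda>j. if j < k then 0 else b' y y') :: real ^ 'l::enum)"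
    by (rule bilinear_vec_of)
  define F :: "real ^ 'l::enum \<Rightarrow> real ^ 'l::enum" where
    "F y = vec_of (\<lambda>j. if j < k then 0 else b' y y)" for y
  show ?thesis
  proof (rule A_equivalent_shearI[OF G linB B])
    show "quadratic_map F"
      by (rule quadratic_mapI[OF linear_zero_map bil, where c=0]) (simp add: F_def)
    show "F (y + F y') = F y" for y y'
    proof -
      have "E (y + F y') = E y"
        by (rule vec_eq_coordI) (auto simp: E_def F_def coord_vec_of cardl)
      then show ?thesis
        by (simp add: F_def[of "y + F y'"] F_def[of y] b'_def cong: if_cong)
    qed
    fix x
    define y where "y = B (?L (p 0 + x) - ?L (p 0))"
    define x' where "x' = inv G (E y)"
    have coord_y: "coord y j = (if j < k then lorentz x (e (j + 1)) else \<tau> * lorentz x x)"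
      if "j < k + 1" for j
      unfolding y_def using that
      by (subst coord_B[where x=x and s="lorentz x x"])
        (auto simp del: coord_simps simp: coord_lorentz_dist_sq_map_diff cardl)
    have perp: "lorentz (x - x') (e j) = 0" if j: "j \<in> {1..k}" for j
    proof -
      have "lorentz x' (e j) = coord (E y) j"
        using coord_G[of j x'] j k by (simp add: x'_def GG)
      also have "\<dots> = lorentz x (e j)"
        using j k coord_y[of "j - 1"] by (auto simp: E_def coord_vec_of)
      finally show ?thesis by (simp add: lorentz_simps)
    qed
    have rad: "b (G z) (G (x - x')) = \<tau> * lorentz z (x - x')" for z
      unfolding G_def by (rule radical) (rule perp)
    have "b (G x) (G x) - b (G x') (G x') = b (G x) (G (x - x')) + b (G x') (G (x - x'))"
      using b_sym[of "G x" "G x'"]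
      by (simp add: linear_diff[OF G(1)] bilinear_rsub[OF b])
    also have "\<dots> = \<tau> * (lorentz x x - lorentz x' x')"
      using lorentz_commute[of x x'] unfolding rad by (simp add: lorentz_simps algebra_simps)
    finally have key: "b (G x) (G x) = \<tau> * lorentz x x + b' y y"
      by (simp add: b'_def GG x'_def[symmetric] algebra_simps) (simp add: x'_def GG)
    have "fold_map k (\<lambda>x. b x x) (G x) = y + F y"
    proof (rule vec_eq_coordI)
      fix j assume "j < CARD('l)"
      then show "coord (fold_map k (\<lambda>x. b x x) (G x) :: real ^ 'l::enum) j = coord (y + F y) j"
        using k by (simp add: fold_map_def coord_vec_of coord_y coord_G F_def cardl key)
    qed
    then show "fold_map k (\<lambda>x. b x x) (G x) =
        B (?L (p 0 + x) - ?L (p 0)) + F (B (?L (p 0 + x) - ?L (p 0)))"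
      by (simp add: y_def)
  qed
qed

text \<open>
  One family covers the polar forms of all normal forms: \<open>i = j = 0\<close> gives \<open>\<rho> x\<^sub>0\<^sup>2\<close>, and \<open>i = 0\<close>,
  \<open>j = 1\<close> gives \<open>\<rho> x\<^sub>0 x\<^sub>1\<close>.
\<close>

lemma bilinear_coord_form:
  "bilinear (\<lambda>x y. \<rho> * (coord x i * coord y j + coord x j * coord y i) / 2
     + (\<Sum>i\<in>I. coord x i * coord y i))"
  unfolding bilinear_def
  by (auto intro!: linearI simp: algebra_simps sum.distrib sum_distrib_left add_divide_distrib)

section \<open>The three causal types\<close>

text \<open>
  Time-like and space-like \<open>V\<close> together, with \<open>\<sigma> = Q(e) = \<plusminus>1\<close>. A vector \<open>w = \<alpha> e + \<Sum> \<gamma>\<^sub>i f\<^sub>i\<close> of \<open>W\<close> has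
  coordinates \<open>\<alpha> \<sigma>\<close> and \<open>\<gamma>\<^sub>i\<close>, which gives the polar form required by \<open>A_equivalent_fold_map\<close>. A factor
  \<open>\<tau> \<noteq> 1\<close> would also rescale the squares of the \<open>\<langle>x, f\<^sub>i\<rangle>\<close>, so it is confined to the case where there are none.
\<close>

lemma A_equivalent_nondegenerate:
  fixes p :: "nat \<Rightarrow> real ^ 'm::enum"
  assumes V_def: "V = recognition_subspace p k"
    and cardl: "CARD('l) = k + 1" and k: "k < CARD('m)" and gp: "general_position p k"
    and e: "e \<in> lorentz_perp V" and \<sigma>: "lorentz e e = \<sigma>" "\<sigma> * \<sigma> = 1"
    and sp: "spacelike {w \<in> lorentz_perp V. lorentz w e = 0}"
    and \<tau>: "\<tau> = 1 \<or> \<tau> \<noteq> 0 \<and> CARD('m) = k + 1"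
  shows "A_equivalent (lorentz_dist_sq_map p :: real ^ 'm::enum \<Rightarrow> real ^ 'l::enum)
    (fold_map k (\<lambda>x. \<tau> * \<sigma> * (coord x 0)\<^sup>2 + (\<Sum>i = k+1..<CARD('m). (coord x i)\<^sup>2)))"
proof -
  have V: "subspace V" "dim V = k"
    using gp by (simp_all add: V_def recognition_subspace_def general_position_def)
  let ?I = "{k+1..<CARD('m)}"
  have ee: "lorentz e e \<noteq> 0"
    using \<sigma> by auto
  obtain f where fW: "\<And>i. i \<in> ?I \<Longrightarrow> f i \<in> lorentz_perp V"
    and fe: "\<And>i. i \<in> ?I \<Longrightarrow> lorentz (f i) e = 0"
    and on: "\<And>i j. i \<in> ?I \<Longrightarrow> j \<in> ?I \<Longrightarrow> lorentz (f i) (f j) = (if i = j then 1 else 0)"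
    and ex: "\<And>w. w \<in> lorentz_perp V \<Longrightarrow> \<exists>\<alpha> \<gamma>. w = \<alpha> *\<^sub>R e + (\<Sum>i\<in>?I. \<gamma> i *\<^sub>R f i)"
    by (rule perp_adapted_basis[OF V(1) linear_lorentz(1) e ee sp, unfolded V(2)], rule that)
  define E where "E i = (if i = 0 then e else if i \<le> k then p i - p 0 else f i)" for i
  have perpI: "w \<in> lorentz_perp V" if "\<And>j. j \<in> {1..k} \<Longrightarrow> lorentz w (E j) = 0" for w
    unfolding V_def recognition_subspace_def lorentz_perp_span
    using that by (auto simp: lorentz_perp_def E_def)
  have expand: "\<exists>\<alpha> \<gamma>. w = \<alpha> *\<^sub>R e + (\<Sum>i\<in>?I. \<gamma> i *\<^sub>R f i) \<and> lorentz w e = \<alpha> * \<sigma> \<and>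
      (\<forall>j\<in>?I. lorentz w (f j) = \<gamma> j)" if W: "w \<in> lorentz_perp V" for w
  proof -
    obtain \<alpha> \<gamma> where w: "w = \<alpha> *\<^sub>R e + (\<Sum>i\<in>?I. \<gamma> i *\<^sub>R f i)"
      using ex[OF W] by blast
    have "lorentz w e = \<alpha> * \<sigma>"
      by (simp add: w lorentz_simps lorentz_sum_left fe \<sigma>)
    moreover have "lorentz w (f j) = \<gamma> j" if "j \<in> ?I" for j
      using lorentz_orthonormal_sum[OF _ that on] fe[OF that]
      by (simp add: w lorentz_simps lorentz_commute[of e])
    ultimately show ?thesis
      using w by blast
  qed
  let ?b = "\<lambda>(x :: real ^ 'm::enum) y. (\<tau> * \<sigma>) * (coord x 0 * coord y 0 + coord x 0 * coord y 0) / 2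
     + (\<Sum>i\<in>?I. coord x i * coord y i)"
  have "A_equivalent (lorentz_dist_sq_map p :: real ^ 'm::enum \<Rightarrow> real ^ 'l::enum)
    (fold_map k (\<lambda>x. ?b x x))"
  proof (rule A_equivalent_fold_map[where b="?b" and e=E and \<tau>=\<tau>])
    show "CARD('l) = k + 1" and "k < CARD('m)" using cardl k .
    show "\<tau> \<noteq> 0" using \<tau> by auto
    show "bilinear ?b" by (rule bilinear_coord_form)
    show "?b x y = ?b y x" for x y by (simp add: mult.commute)
    show "E j \<in> recognition_subspace p k" if "j \<in> {1..k}" for j
      using that by (auto simp: E_def recognition_subspace_def intro: span_base)
  next
    fix x assume x: "\<And>i. i < CARD('m) \<Longrightarrow> lorentz x (E i) = 0"
    have "x \<in> lorentz_perp V"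
      using x k by (intro perpI) auto
    then obtain \<alpha> \<gamma> where "x = \<alpha> *\<^sub>R e + (\<Sum>i\<in>?I. \<gamma> i *\<^sub>R f i)" "lorentz x e = \<alpha> * \<sigma>"
      "\<forall>j\<in>?I. lorentz x (f j) = \<gamma> j"
      using expand by blast
    moreover have "lorentz x e = 0"
      using x[of 0] by (simp add: E_def)
    moreover have "lorentz x (f j) = 0" if "j \<in> ?I" for j
      using x[of j] that by (simp add: E_def)
    ultimately show "x = 0"
      using \<sigma>(2) by auto
  next
    fix x w assume "\<And>j. j \<in> {1..k} \<Longrightarrow> lorentz w (E j) = 0"
    then obtain \<alpha> \<gamma> where w: "w = \<alpha> *\<^sub>R e + (\<Sum>i\<in>?I. \<gamma> i *\<^sub>R f i)" "lorentz w e = \<alpha> * \<sigma>"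
      "\<forall>j\<in>?I. lorentz w (f j) = \<gamma> j"
      using expand[OF perpI] by blast
    have 0: "coord (lorentz_coords E y) 0 = lorentz y e" for y
      by (simp add: coord_lorentz_coords E_def)
    have i: "coord (lorentz_coords E y) i = lorentz y (f i)" if "i \<in> ?I" for y i
      using that by (simp add: coord_lorentz_coords E_def)
    have "?b (lorentz_coords E x) (lorentz_coords E w) =
        \<tau> * \<sigma> * (lorentz x e * (\<alpha> * \<sigma>)) + (\<Sum>i\<in>?I. lorentz x (f i) * \<gamma> i)"
      using w(2,3) by (simp add: 0 i)
    also have "\<tau> * \<sigma> * (lorentz x e * (\<alpha> * \<sigma>)) = \<tau> * (\<sigma> * \<sigma>) * (\<alpha> * lorentz x e)"
      by (simp add: mult_ac)
    also have "\<tau> * (\<sigma> * \<sigma>) * (\<alpha> * lorentz x e) + (\<Sum>i\<in>?I. lorentz x (f i) * \<gamma> i)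
        = \<tau> * (\<alpha> * lorentz x e + (\<Sum>i\<in>?I. lorentz x (f i) * \<gamma> i))"
      using \<tau> \<sigma>(2) by auto
    also have "\<alpha> * lorentz x e + (\<Sum>i\<in>?I. lorentz x (f i) * \<gamma> i) = lorentz x w"
      by (simp add: w(1) lorentz_simps lorentz_sum_right mult.commute)
    finally show "?b (lorentz_coords E x) (lorentz_coords E w) = \<tau> * lorentz x w" .
  qed
  then show ?thesis
    by (simp add: power2_eq_square mult.assoc)
qed

lemma A_equivalent_of_timelike:
  fixes p :: "nat \<Rightarrow> real ^ 'm::enum"
  assumes cardl: "CARD('l) = k + 1" and k: "k < CARD('m)" and gp: "general_position p k"
    and time: "timelike (recognition_subspace p k)"
  shows "A_equivalent (lorentz_dist_sq_map p :: real ^ 'm::enum \<Rightarrow> real ^ 'l::enum) (definite_fold k)"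
proof -
  let ?V = "recognition_subspace p k"
  have V: "subspace ?V" "dim ?V = k"
    using gp by (simp_all add: recognition_subspace_def general_position_def)
  have sp: "spacelike (lorentz_perp ?V)"
    by (rule spacelike_perp_of_timelike[OF time])
  have "dim (lorentz_perp ?V) \<noteq> 0"
    using dim_lorentz_perp[OF V(1)] V(2) k by linarith
  then obtain w where w: "w \<in> lorentz_perp ?V" "w \<noteq> 0"
    by auto
  then have ww: "lorentz w w > 0"
    using sp by (auto simp: spacelike_def spacelike_vector_def)
  let ?e = "(1 / sqrt (lorentz w w)) *\<^sub>R w"
  have "A_equivalent (lorentz_dist_sq_map p :: real ^ 'm::enum \<Rightarrow> real ^ 'l::enum)
    (fold_map k (\<lambda>x. 1 * 1 * (coord x 0)\<^sup>2 + (\<Sum>i = k+1..<CARD('m). (coord x i)\<^sup>2)))"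
  proof (rule A_equivalent_nondegenerate[OF refl cardl k gp, where e = ?e])
    show "?e \<in> lorentz_perp ?V"
      using w(1) by (simp add: subspace_scale subspace_lorentz_perp)
    show "lorentz ?e ?e = 1"
      using ww by (simp add: lorentz_simps)
    show "spacelike {x \<in> lorentz_perp ?V. lorentz x ?e = 0}"
      using sp by (auto simp: spacelike_def)
  qed auto
  then show ?thesis
    unfolding definite_fold_eq_fold_map by simp
qed

text \<open>
  With \<open>\<tau> = 1\<close> the normal form is the Lorentzian indefinite fold; with \<open>\<tau> = -1\<close>, available when \<open>W\<close> is a
  line, it is the definite fold.
\<close>

lemma A_equivalent_of_spacelike:
  fixes p :: "nat \<Rightarrow> real ^ 'm::enum"
  assumes cardl: "CARD('l) = k + 1" and k: "k < CARD('m)" and gp: "general_position p k"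
    and space: "spacelike (recognition_subspace p k)"
    and \<tau>: "\<tau> = 1 \<or> \<tau> \<noteq> 0 \<and> CARD('m) = k + 1"
  shows "A_equivalent (lorentz_dist_sq_map p :: real ^ 'm::enum \<Rightarrow> real ^ 'l::enum)
    (fold_map k (\<lambda>x. \<tau> * - 1 * (coord x 0)\<^sup>2 + (\<Sum>i = k+1..<CARD('m). (coord x i)\<^sup>2)))"
proof -
  let ?V = "recognition_subspace p k"
  have V: "subspace ?V"
    by (simp add: recognition_subspace_def)
  obtain w where w: "w \<in> lorentz_perp ?V" "lorentz w w < 0"
    using exists_timelike_perp_of_spacelike[OF V space] by blast
  let ?e = "(1 / sqrt (- lorentz w w)) *\<^sub>R w"
  show ?thesis
  proof (rule A_equivalent_nondegenerate[OF refl cardl k gp, where e = ?e])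
    show "?e \<in> lorentz_perp ?V"
      using w(1) by (simp add: subspace_scale subspace_lorentz_perp)
    show ee: "lorentz ?e ?e = - 1"
      using w(2) by (simp add: lorentz_simps)
    show "spacelike {x \<in> lorentz_perp ?V. lorentz x ?e = 0}"
      unfolding spacelike_def spacelike_vector_def
    proof (intro ballI impI conjI)
      fix x assume "x \<in> {x \<in> lorentz_perp ?V. lorentz x ?e = 0}" and "x \<noteq> 0"
      then show "lorentz x x > 0"
        using ee by (intro lorentz_pos_if_perp_timelike[of ?e]) (auto simp: lorentz_commute)
    qed
  qed (use \<tau> in auto)
qed

text \<open>
  Here \<open>u\<close> lies in \<open>V\<close> and in \<open>W\<close>, so \<open>\<langle>x, u\<rangle>\<close> vanishes on \<open>W\<close> and cannot measure the component along
  \<open>u\<close>; the time coordinate can, since \<open>u\<^sub>0 = 1\<close> and the \<open>f\<^sub>i\<close> have time coordinate \<open>0\<close>. The basis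
  of \<open>V\<close> is changed to begin with \<open>u\<close>, because the normal form pairs \<open>x\<^sub>0\<close> with \<open>x\<^sub>1\<close>. For \<open>w = \<alpha> u + \<Sum> \<gamma>\<^sub>i f\<^sub>i\<close>
  the polar form of \<open>2 x\<^sub>0 \<langle>x, u\<rangle> + \<Sum> \<langle>x, f\<^sub>i\<rangle>\<^sup>2\<close> against \<open>w\<close> is \<open>\<alpha> \<langle>x, u\<rangle> + \<Sum> \<gamma>\<^sub>i \<langle>x, f\<^sub>i\<rangle> = \<langle>x, w\<rangle>\<close>.
\<close>

lemma A_equivalent_of_lightlike:
  fixes p :: "nat \<Rightarrow> real ^ 'm::enum"
  assumes cardl: "CARD('l) = k + 1" and k: "k < CARD('m)" and gp: "general_position p k"
    and light: "lightlike (recognition_subspace p k)"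
  shows "A_equivalent (lorentz_dist_sq_map p :: real ^ 'm::enum \<Rightarrow> real ^ 'l::enum)
    (fold_map k (\<lambda>x. coord x 0 * coord x 1 + (\<Sum>i = k+1..<CARD('m). (coord x i)\<^sup>2)))"
proof -
  define V where "V = recognition_subspace p k"
  have V: "subspace V" "dim V = k"
    using gp by (simp_all add: V_def recognition_subspace_def general_position_def)
  let ?I = "{k+1..<CARD('m)}"
  obtain u where u: "u \<in> V" "u \<in> lorentz_perp V" "coord u 0 = 1"
    using exists_null_vector_of_lightlike[OF V(1)] light by (auto simp: V_def)
  then have "u \<noteq> 0" by auto
  then obtain g where g: "g 1 = u" "\<And>j. j \<in> {1..k} \<Longrightarrow> g j \<in> V" "V \<subseteq> span (g ` {1..k})" "k \<ge> 1"
    using basis_with_first_vector[OF u(1)] V(2) by metis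
  have sp: "spacelike {w \<in> lorentz_perp V. coord w 0 = 0}"
    using lorentz_pos_if_time_coord_zero by (auto simp: spacelike_def spacelike_vector_def)
  obtain f where fW: "\<And>i. i \<in> ?I \<Longrightarrow> f i \<in> lorentz_perp V"
    and f0: "\<And>i. i \<in> ?I \<Longrightarrow> coord (f i) 0 = 0"
    and on: "\<And>i j. i \<in> ?I \<Longrightarrow> j \<in> ?I \<Longrightarrow> lorentz (f i) (f j) = (if i = j then 1 else 0)"
    and ex: "\<And>w. w \<in> lorentz_perp V \<Longrightarrow> \<exists>\<alpha> \<gamma>. w = \<alpha> *\<^sub>R u + (\<Sum>i\<in>?I. \<gamma> i *\<^sub>R f i)"
    by (rule perp_adapted_basis[OF V(1) linear_coord u(2) _ sp, unfolded V(2)])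
      (simp add: u(3), rule that)
  \<comment> \<open>The factor \<open>2\<close> in \<open>\<langle>x, t\<rangle> = 2 x\<^sub>0\<close> cancels the \<open>1/2\<close> in the polar form of \<open>x\<^sub>0 x\<^sub>1\<close>.\<close>
  define t :: "real ^ 'm::enum" where "t = vec_of (\<lambda>i. if i = 0 then -2 else 0)"
  have t: "lorentz x t = 2 * coord x 0" for x
    by (simp add: lorentz_def t_def coord_vec_of)
  define E where "E i = (if i = 0 then t else if i \<le> k then g i else f i)" for i
  have perpI: "w \<in> lorentz_perp V" if "\<And>j. j \<in> {1..k} \<Longrightarrow> lorentz w (E j) = 0" for w
  proof -
    have "w \<in> lorentz_perp (span (g ` {1..k}))"
      unfolding lorentz_perp_span using that by (auto simp: lorentz_perp_def E_def)
    then show ?thesis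
      using g(3) by (auto simp: lorentz_perp_def)
  qed
  have fu: "lorentz (f i) u = 0" if "i \<in> ?I" for i
    using fW[OF that] u(1) by (simp add: lorentz_perp_def)
  have expand: "\<exists>\<alpha> \<gamma>. w = \<alpha> *\<^sub>R u + (\<Sum>i\<in>?I. \<gamma> i *\<^sub>R f i) \<and> coord w 0 = \<alpha> \<and>
      lorentz w u = 0 \<and> (\<forall>j\<in>?I. lorentz w (f j) = \<gamma> j)" if W: "w \<in> lorentz_perp V" for w
  proof -
    obtain \<alpha> \<gamma> where w: "w = \<alpha> *\<^sub>R u + (\<Sum>i\<in>?I. \<gamma> i *\<^sub>R f i)"
      using ex[OF W] by blast
    have "coord w 0 = \<alpha>"
      using linear_sum[OF linear_coord[of 0], of "\<lambda>i. \<gamma> i *\<^sub>R f i" ?I] f0 u(3) by (simp add: w)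
    moreover have "lorentz w (f j) = \<gamma> j" if "j \<in> ?I" for j
      using lorentz_orthonormal_sum[OF _ that on] fu[OF that]
      by (simp add: w lorentz_simps lorentz_commute[of u])
    moreover have "lorentz w u = 0"
      using W u(1) by (simp add: lorentz_perp_def)
    ultimately show ?thesis
      using w by blast
  qed
  let ?b = "\<lambda>(x :: real ^ 'm::enum) y. 1 * (coord x 0 * coord y 1 + coord x 1 * coord y 0) / 2
     + (\<Sum>i\<in>?I. coord x i * coord y i)"
  have "A_equivalent (lorentz_dist_sq_map p :: real ^ 'm::enum \<Rightarrow> real ^ 'l::enum)
    (fold_map k (\<lambda>x. ?b x x))"
  proof (rule A_equivalent_fold_map[where b="?b" and e=E and \<tau>=1])
    show "CARD('l) = k + 1" and "k < CARD('m)" using cardl k .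
    show "bilinear ?b" by (rule bilinear_coord_form)
    show "?b x y = ?b y x" for x y by (simp add: mult.commute)
    show "E j \<in> recognition_subspace p k" if "j \<in> {1..k}" for j
      using that g(2) by (auto simp: E_def V_def)
  next
    fix x assume x: "\<And>i. i < CARD('m) \<Longrightarrow> lorentz x (E i) = 0"
    have "x \<in> lorentz_perp V"
      using x k by (intro perpI) auto
    then obtain \<alpha> \<gamma> where "x = \<alpha> *\<^sub>R u + (\<Sum>i\<in>?I. \<gamma> i *\<^sub>R f i)" "coord x 0 = \<alpha>"
      "\<forall>j\<in>?I. lorentz x (f j) = \<gamma> j"
      using expand by blast
    moreover have "coord x 0 = 0"
      using x[of 0] t[of x] by (simp add: E_def)
    moreover have "lorentz x (f j) = 0" if "j \<in> ?I" for j
      using x[of j] that by (simp add: E_def)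
    ultimately show "x = 0"
      by auto
  next
    fix x w assume "\<And>j. j \<in> {1..k} \<Longrightarrow> lorentz w (E j) = 0"
    then obtain \<alpha> \<gamma> where w: "w = \<alpha> *\<^sub>R u + (\<Sum>i\<in>?I. \<gamma> i *\<^sub>R f i)" "coord w 0 = \<alpha>"
      "lorentz w u = 0" "\<forall>j\<in>?I. lorentz w (f j) = \<gamma> j"
      using expand[OF perpI] by blast
    have 0: "coord (lorentz_coords E y) 0 = 2 * coord y 0" for y
      by (simp add: coord_lorentz_coords E_def t)
    have 1: "coord (lorentz_coords E y) 1 = lorentz y u" for y
      using g(1,4) k by (simp add: coord_lorentz_coords E_def)
    have i: "coord (lorentz_coords E y) i = lorentz y (f i)" if "i \<in> ?I" for y i
      using that by (simp add: coord_lorentz_coords E_def)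
    have "?b (lorentz_coords E x) (lorentz_coords E w) =
        \<alpha> * lorentz x u + (\<Sum>i\<in>?I. \<gamma> i * lorentz x (f i))"
      using w(2-4) unfolding 0 1 by (simp add: i mult.commute)
    also have "\<dots> = 1 * lorentz x w"
      by (simp add: w(1) lorentz_simps lorentz_sum_right)
    finally show "?b (lorentz_coords E x) (lorentz_coords E w) = 1 * lorentz x w" .
  qed simp
  then show ?thesis
    by (simp add: power2_eq_square)
qed

section \<open>More points than dimensions\<close>

text \<open>
  Since \<open>p\<^sub>1 - p\<^sub>0, \<dots>, p\<^sub>n\<^sub>+\<^sub>1 - p\<^sub>0\<close> span the whole space, their forms are linear coordinates on the source.
  After the affine change \<open>B\<close> the target shows these coordinates in its first \<open>n + 1\<close> places, from which
  the remaining forms and \<open>Q\<close> can be computed and subtracted.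
\<close>

lemma A_equivalent_inclusion:
  fixes p :: "nat \<Rightarrow> real ^ 'm::enum"
  assumes cardm: "CARD('m) = n + 1" and cardl: "CARD('l) = k + 1" and "n < k"
    and gp: "general_position p (n + 1)"
  shows "A_equivalent (lorentz_dist_sq_map p :: real ^ 'm::enum \<Rightarrow> real ^ 'l::enum)
    (\<lambda>x. vec_of (\<lambda>j. if j \<le> n then coord x j else 0))"
proof -
  let ?L = "lorentz_dist_sq_map p :: real ^ 'm::enum \<Rightarrow> real ^ 'l::enum"
  let ?V = "recognition_subspace p (n + 1)"
  define v where "v i = p (i + 1) - p 0" for i
  define G where "G = lorentz_coords v"
  have "dim (lorentz_perp ?V) = 0"
    using dim_lorentz_perp[of ?V] gp cardm
    by (simp add: recognition_subspace_def general_position_def)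
  then have perp: "lorentz_perp ?V \<subseteq> {0}"
    by simp
  have nondeg: "x = 0" if x: "\<And>i. i < CARD('m) \<Longrightarrow> lorentz x (v i) = 0" for x
  proof -
    have "lorentz x (p i - p 0) = 0" if "i \<in> {1..n+1}" for i
      using x[of "i - 1"] that cardm by (auto simp: v_def)
    then have "x \<in> lorentz_perp ?V"
      unfolding recognition_subspace_def lorentz_perp_span by (auto simp: lorentz_perp_def)
    then show ?thesis
      using perp by auto
  qed
  have G: "linear G" "bij G"
    unfolding G_def by (rule linear_lorentz_coords, rule bij_lorentz_coords[OF nondeg])
  have G': "linear (inv G)"
    using G by (simp add: inj_linear_imp_inv_linear bij_is_inj)
  have GG: "inv G (G x) = x" for x
    using G(2) by (simp add: bij_is_inj)
  define B :: "real ^ 'l::enum \<Rightarrow> real ^ 'l::enum" where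
    "B z = vec_of (\<lambda>j. if j < k then (coord z 0 - coord z (j + 1)) / 2 else coord z 0)" for z
  have coord_B: "coord (B z) j = (if j < k then (coord z 0 - coord z (j + 1)) / 2 else coord z 0)"
    if "j < k + 1" for z j
    using that by (simp add: B_def coord_vec_of cardl)
  have linB: "linear B"
    unfolding B_def
    by (intro linear_vec_of linearI) (simp_all add: algebra_simps add_divide_distrib diff_divide_distrib)
  have "inj B"
  proof (subst linear_injective_0[OF linB], intro allI impI)
    fix z assume "B z = 0"
    then have B0: "coord (B z) j = 0" for j
      by simp
    have z0: "coord z 0 = 0"
      using B0[of k] by (simp add: coord_B)
    show "z = 0"
    proof (rule vec_eq_coordI)
      fix i assume "i < CARD('l)"
      then show "coord z i = coord 0 i"
        using B0[of "i - 1"] z0 cardl by (cases i) (simp_all add: coord_B)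
    qed
  qed
  then have B: "bij B"
    using linear_injective_imp_surjective[OF linB] by (auto simp: bij_def)
  define E :: "real ^ 'l::enum \<Rightarrow> real ^ 'm::enum" where "E y = inv G (vec_of (coord y))" for y
  have linE: "linear E"
    unfolding E_def
    by (rule linear_compose_fun[OF _ G'], rule linear_vec_of, rule linear_coord)
  define l :: "real ^ 'l::enum \<Rightarrow> real ^ 'l::enum" where
    "l y = vec_of (\<lambda>j. if n < j \<and> j < k then - lorentz (E y) (v j) else 0)" for y
  define b :: "real ^ 'l::enum \<Rightarrow> real ^ 'l::enum \<Rightarrow> real ^ 'l::enum" where
    "b y y' = vec_of (\<lambda>j. if j = k then - lorentz (E y) (E y') else 0)" for y y'
  have linl: "linear l"
    unfolding l_def
    by (intro linear_vec_of linearI)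
      (simp_all add: linear_add[OF linE] linear_scale[OF linE] lorentz_simps)
  have bilb: "bilinear b"
    unfolding b_def
    by (intro bilinear_vec_of, unfold bilinear_def, intro conjI allI linearI)
      (simp_all add: linear_add[OF linE] linear_scale[OF linE] lorentz_simps)
  let ?F = "\<lambda>y. 0 + l y + b y y"
  show ?thesis
  proof (rule A_equivalent_shearI[OF G linB B])
    show "quadratic_map ?F"
      by (rule quadratic_mapI[OF linl bilb refl])
    show "?F (y + ?F y') = ?F y" for y y'
    proof -
      have "(vec_of (coord (y + ?F y')) :: real ^ 'm::enum) = vec_of (coord y)"
        using cardm cardl \<open>n < k\<close> by (intro vec_eq_coordI) (simp add: coord_vec_of l_def b_def)
      then have "E (y + ?F y') = E y"
        by (simp only: E_def)
      then show ?thesis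
        by (simp only: l_def b_def)
    qed
    fix x
    define y where "y = B (?L (p 0 + x) - ?L (p 0))"
    have coord_y: "coord y j = (if j < k then lorentz x (v j) else lorentz x x)" if "j < k + 1" for j
      unfolding y_def using that
      by (auto simp del: coord_simps simp: coord_B coord_lorentz_dist_sq_map_diff cardl v_def lorentz_simps)
    have "(vec_of (coord y) :: real ^ 'm::enum) = G x"
      using cardm cardl \<open>n < k\<close>
      by (intro vec_eq_coordI) (simp add: coord_vec_of coord_y G_def coord_lorentz_coords)
    then have E: "E y = x"
      by (simp add: E_def GG)
    have "vec_of (\<lambda>j. if j \<le> n then coord (G x) j else 0) = y + ?F y"
    proof (rule vec_eq_coordI)
      fix j assume "j < CARD('l)"
      then show "coord (vec_of (\<lambda>j. if j \<le> n then coord (G x) j else 0) :: real ^ 'l::enum) j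
          = coord (y + ?F y) j"
        using cardm cardl \<open>n < k\<close>
        by (auto simp: coord_vec_of coord_y l_def b_def E G_def coord_lorentz_coords)
    qed
    then show "vec_of (\<lambda>j. if j \<le> n then coord (G x) j else 0) =
        B (?L (p 0 + x) - ?L (p 0)) + ?F (B (?L (p 0 + x) - ?L (p 0)))"
      by (simp only: y_def)
  qed
qed

section \<open>Telling the normal forms apart\<close>

definition has_singleton_fibre :: "('a \<Rightarrow> 'b) \<Rightarrow> bool" where
  "has_singleton_fibre f \<longleftrightarrow> (\<exists>x. \<forall>y. f y = f x \<longrightarrow> y = x)"

definition has_three_point_fibre :: "('a \<Rightarrow> 'b) \<Rightarrow> bool" where
  "has_three_point_fibre f \<longleftrightarrow> (\<exists>x y z. x \<noteq> y \<and> y \<noteq> z \<and> x \<noteq> z \<and> f x = f y \<and> f y = f z)"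

lemma A_equivalent_imp_bij:
  assumes "A_equivalent f g"
  obtains h H where "bij h" and "bij H" and "g = H \<circ> f \<circ> h"
  using assms by (auto simp: A_equivalent_def diffeomorphism_def)

lemma A_equivalent_surj_iff:
  assumes "A_equivalent f g"
  shows "surj g \<longleftrightarrow> surj f"
proof -
  obtain h H where h: "bij h" and H: "bij H" and g: "g = H \<circ> f \<circ> h"
    using A_equivalent_imp_bij[OF assms] .
  show ?thesis
  proof
    assume "surj f"
    then show "surj g"
      unfolding g using h H by (intro comp_surj) (simp_all add: bij_is_surj)
  next
    assume surj_g: "surj g"
    show "surj f"
    proof (rule surjI)
      fix y
      have "H (f (h (inv g (H y)))) = H y"
        using surj_f_inv_f[OF surj_g, of "H y"] by (simp add: g)
      then show "f (h (inv g (H y))) = y"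
        using H by (simp add: bij_is_inj inj_eq)
    qed
  qed
qed

lemma A_equivalent_fibre_iff:
  assumes "A_equivalent f g"
  shows "has_singleton_fibre g \<longleftrightarrow> has_singleton_fibre f"
    and "has_three_point_fibre g \<longleftrightarrow> has_three_point_fibre f"
proof -
  obtain h H where h: "bij h" and H: "bij H" and g: "g = H \<circ> f \<circ> h"
    using A_equivalent_imp_bij[OF assms] .
  have gf: "g x = g y \<longleftrightarrow> f (h x) = f (h y)" for x y
    using H by (simp add: g bij_is_inj inj_eq)
  have hh: "h x = h y \<longleftrightarrow> x = y" for x y
    using h by (simp add: bij_is_inj inj_eq)
  obtain h' where h': "h (h' z) = z" for z
    using bij_is_surj[OF h] surj_f_inv_f by metis
  show "has_singleton_fibre g \<longleftrightarrow> has_singleton_fibre f"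
    unfolding has_singleton_fibre_def gf by (metis h' hh)
  show "has_three_point_fibre g \<longleftrightarrow> has_three_point_fibre f"
    unfolding has_three_point_fibre_def gf by (metis h' hh)
qed

lemma fold_map_eq_iff:
  assumes "CARD('l) = k + 1"
  shows "(fold_map k N x :: real ^ 'l::enum) = fold_map k N y \<longleftrightarrow>
    (\<forall>j\<in>{1..k}. coord x j = coord y j) \<and> N x = N y" (is "?lhs \<longleftrightarrow> ?rhs")
proof
  assume ?lhs
  then have eq: "coord (fold_map k N x :: real ^ 'l::enum) j = coord (fold_map k N y :: real ^ 'l::enum) j"
    for j by simp
  have "coord x j = coord y j" if "j \<in> {1..k}" for j
    using eq[of "j - 1"] that assms by (cases j) (simp_all add: fold_map_def coord_vec_of)
  moreover have "N x = N y"
    using eq[of k] assms by (simp add: fold_map_def coord_vec_of)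
  ultimately show ?rhs by simp
next
  assume ?rhs
  then show ?lhs
    by (intro vec_eq_coordI) (simp add: fold_map_def coord_vec_of)
qed

text \<open>
  The point \<open>(0, \<dots>, 0, -1)\<close> is missed.
\<close>

lemma not_surj_fold_map:
  assumes "CARD('l) = k + 1" and "\<And>x. (\<And>j. j \<in> {1..k} \<Longrightarrow> coord x j = 0) \<Longrightarrow> N x \<ge> 0"
  shows "\<not> surj (fold_map k N :: real ^ 'm::enum \<Rightarrow> real ^ 'l::enum)"
proof
  assume "surj (fold_map k N :: real ^ 'm::enum \<Rightarrow> real ^ 'l::enum)"
  then obtain x :: "real ^ 'm::enum" where
    x: "vec_of (\<lambda>j. if j < k then 0 else - 1) = (fold_map k N x :: real ^ 'l::enum)"
    by (meson surjE)
  have eq: "(if j < k then 0 else - 1) = coord (fold_map k N x :: real ^ 'l::enum) j" if "j < k + 1" for j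
    using arg_cong[OF x, of "\<lambda>y. coord y j"] that assms(1) by (simp add: coord_vec_of)
  have "coord x j = 0" if "j \<in> {1..k}" for j
    using eq[of "j - 1"] that assms(1) by (cases j) (simp_all add: fold_map_def coord_vec_of)
  then have "N x \<ge> 0"
    by (rule assms(2))
  moreover have "N x = - 1"
    using eq[of k] assms(1) by (simp add: fold_map_def coord_vec_of)
  ultimately show False by simp
qed

lemma definite_fold_not_surj:
  assumes "CARD('l) = k + 1"
  shows "\<not> surj (definite_fold k :: real ^ 'm::enum \<Rightarrow> real ^ 'l::enum)"
  unfolding definite_fold_eq_fold_map
  by (rule not_surj_fold_map[OF assms]) (simp add: sum_nonneg)

text \<open>
  As \<open>k < n\<close>, a squared coordinate \<open>x\<^sub>k\<^sub>+\<^sub>1\<close> is available, and every real \<open>d\<close> is the difference of the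
  squares of \<open>(d + 1) / 2\<close> and \<open>(d - 1) / 2\<close>.
\<close>

lemma lorentz_indefinite_fold_surj:
  assumes "CARD('l) = k + 1" and "k + 1 < CARD('m)"
  shows "surj (lorentz_indefinite_fold k :: real ^ 'm::enum \<Rightarrow> real ^ 'l::enum)"
proof (unfold surj_def, intro allI)
  fix z :: "real ^ 'l::enum"
  let ?d = "coord z k"
  define x :: "real ^ 'm::enum" where
    "x = vec_of (\<lambda>i. if i = 0 then (?d - 1) / 2 else if i \<le> k then coord z (i - 1)
       else if i = k + 1 then (?d + 1) / 2 else 0)"
  have "(\<Sum>i = k+1..<CARD('m). (coord x i)\<^sup>2) = (\<Sum>i = k+1..<CARD('m). if i = k + 1 then ((?d + 1) / 2)\<^sup>2 else 0)"
    by (intro sum.cong) (auto simp: x_def coord_vec_of)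
  also have "\<dots> = ((?d + 1) / 2)\<^sup>2"
    using assms(2) by simp
  finally have "- (coord x 0)\<^sup>2 + (\<Sum>i = k+1..<CARD('m). (coord x i)\<^sup>2) = ?d"
    by (simp add: x_def coord_vec_of power2_eq_square field_simps)
  then have "lorentz_indefinite_fold k x = z"
    using assms by (intro vec_eq_coordI)
      (auto simp: lorentz_indefinite_fold_eq_fold_map fold_map_def coord_vec_of less_Suc_eq,
       auto simp: x_def coord_vec_of)
  then show "\<exists>x. z = (lorentz_indefinite_fold k (x :: real ^ 'm::enum) :: real ^ 'l::enum)"
    by blast
qed

lemma definite_fold_has_singleton_fibre:
  assumes "CARD('l) = k + 1"
  shows "has_singleton_fibre (definite_fold k :: real ^ 'm::enum \<Rightarrow> real ^ 'l::enum)"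
  unfolding has_singleton_fibre_def definite_fold_eq_fold_map fold_map_eq_iff[OF assms]
proof (intro exI[of _ 0] allI impI)
  fix y :: "real ^ 'm::enum"
  assume y: "(\<forall>j\<in>{1..k}. coord y j = coord 0 j) \<and>
    (coord y 0)\<^sup>2 + (\<Sum>i = k+1..<CARD('m). (coord y i)\<^sup>2) =
    (coord (0 :: real ^ 'm::enum) 0)\<^sup>2 + (\<Sum>i = k+1..<CARD('m). (coord (0 :: real ^ 'm::enum) i)\<^sup>2)"
  then have "(coord y 0)\<^sup>2 + (\<Sum>i = k+1..<CARD('m). (coord y i)\<^sup>2) = 0"
    by simp
  then have "coord y 0 = 0" and "(\<Sum>i = k+1..<CARD('m). (coord y i)\<^sup>2) = 0"
    by (simp_all add: add_nonneg_eq_0_iff sum_nonneg)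
  then have "\<forall>i\<in>{k+1..<CARD('m)}. coord y i = 0"
    by (subst (asm) sum_nonneg_eq_0_iff) auto
  then show "y = 0"
    using y \<open>coord y 0 = 0\<close>
    by (intro vec_eq_coordI) (metis One_nat_def Suc_eq_plus1 atLeastAtMost_iff atLeastLessThan_iff
        coord_simps(5) less_one not_less not_less_eq_eq)
qed

text \<open>
  For \<open>k = n\<close> a point of a fibre is determined up to the sign of \<open>x\<^sub>0\<close>.
\<close>

lemma definite_fold_no_three_point_fibre:
  assumes "CARD('l) = k + 1" and "CARD('m) = k + 1"
  shows "\<not> has_three_point_fibre (definite_fold k :: real ^ 'm::enum \<Rightarrow> real ^ 'l::enum)"
proof -
  have eq: "x = y" if "\<forall>j\<in>{1..k}. coord x j = coord y j" "coord x 0 = coord y 0"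
    for x y :: "real ^ 'm::enum"
    using that assms(2)
    by (intro vec_eq_coordI) (metis One_nat_def Suc_eq_plus1 atLeastAtMost_iff less_Suc_eq_le
        less_one not_less)
  show ?thesis
    unfolding has_three_point_fibre_def definite_fold_eq_fold_map fold_map_eq_iff[OF assms(1)]
    using eq assms(2) by (auto simp: power2_eq_iff)
qed

text \<open>
  Each point \<open>x\<close> has a companion in its fibre: if \<open>x\<^sub>1 = 0\<close> the coordinate \<open>x\<^sub>0\<close> is free; otherwise raise \<open>x\<^sub>k\<^sub>+\<^sub>1\<close>
  by one and let \<open>x\<^sub>0 x\<^sub>1\<close> compensate the change of \<open>x\<^sub>k\<^sub>+\<^sub>1\<^sup>2\<close>.
\<close>

lemma null_fold_no_singleton_fibre:
  assumes cardl: "CARD('l) = k + 1" and "k \<ge> 1" and "k + 1 < CARD('m)"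
  shows "\<not> has_singleton_fibre (fold_map k (\<lambda>x. coord x 0 * coord x 1 +
    (\<Sum>i = k+1..<CARD('m). (coord x i)\<^sup>2)) :: real ^ 'm::enum \<Rightarrow> real ^ 'l::enum)"
proof
  let ?N = "\<lambda>x :: real ^ 'm::enum. coord x 0 * coord x 1 + (\<Sum>i = k+1..<CARD('m). (coord x i)\<^sup>2)"
  assume "has_singleton_fibre (fold_map k ?N :: real ^ 'm::enum \<Rightarrow> real ^ 'l::enum)"
  then obtain x :: "real ^ 'm::enum" where x: "\<And>y. (\<forall>j\<in>{1..k}. coord y j = coord x j) \<Longrightarrow> ?N y = ?N x \<Longrightarrow> y = x"
    unfolding has_singleton_fibre_def fold_map_eq_iff[OF cardl] by blast
  let ?a = "coord x (k + 1)"
  define y :: "real ^ 'm::enum" where "y = vec_of (\<lambda>i.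
    if i = 0 then (if coord x 1 = 0 then coord x 0 + 1 else coord x 0 - (1 + 2 * ?a) / coord x 1)
    else if i = k + 1 \<and> coord x 1 \<noteq> 0 then ?a + 1 else coord x i)"
  have y: "coord y j = coord x j" if "j \<in> {1..k}" for j
    using that assms by (simp add: y_def coord_vec_of)
  have "?N y = ?N x"
  proof (cases "coord x 1 = 0")
    case True
    then show ?thesis
      using y[of 1] \<open>k \<ge> 1\<close> by (auto simp: y_def coord_vec_of)
  next
    case False
    have "{k+1..<CARD('m)} = insert (k + 1) {k+2..<CARD('m)}"
      using assms by auto
    moreover have "(\<Sum>i = k+2..<CARD('m). (coord y i)\<^sup>2) = (\<Sum>i = k+2..<CARD('m). (coord x i)\<^sup>2)"
      by (intro sum.cong) (auto simp: y_def coord_vec_of)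
    moreover have "coord y (k + 1) = ?a + 1"
      using False assms by (simp add: y_def coord_vec_of)
    moreover have "coord y 0 * coord y 1 = coord x 0 * coord x 1 - (1 + 2 * ?a)"
      using False assms y[of 1] by (simp add: y_def coord_vec_of field_simps)
    ultimately show ?thesis
      by (simp add: power2_eq_square algebra_simps)
  qed
  then have "y = x"
    using y by (intro x) auto
  then have "coord y 0 = coord x 0" and "coord y (k + 1) = coord x (k + 1)"
    by simp_all
  then show False
    using assms by (cases "coord x 1 = 0") (simp_all add: y_def coord_vec_of)
qed

text \<open>
  The whole \<open>x\<^sub>0\<close>-axis is mapped to the origin.
\<close>

lemma null_fold_has_three_point_fibre:
  assumes cardl: "CARD('l) = k + 1" and "k \<ge> 1" and "k < CARD('m)"
  shows "has_three_point_fibre (fold_map k (\<lambda>x. coord x 0 * coord x 1 +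
    (\<Sum>i = k+1..<CARD('m). (coord x i)\<^sup>2)) :: real ^ 'm::enum \<Rightarrow> real ^ 'l::enum)"
proof -
  define a :: "real \<Rightarrow> real ^ 'm::enum" where "a r = vec_of (\<lambda>i. if i = 0 then r else 0)" for r
  have a0: "coord (a r) 0 = r" for r
    by (simp add: a_def coord_vec_of)
  have ai: "i \<noteq> 0 \<Longrightarrow> i < CARD('m) \<Longrightarrow> coord (a r) i = 0" for r i
    by (simp add: a_def coord_vec_of)
  have inj: "a r = a s \<longleftrightarrow> r = s" for r s
    using a0 by metis
  show ?thesis
    unfolding has_three_point_fibre_def fold_map_eq_iff[OF cardl]
    by (intro exI[of _ "a 0"] exI[of _ "a 1"] exI[of _ "a 2"]) (use assms in \<open>auto simp: inj ai\<close>)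
qed

section \<open>Classification\<close>

theorem theorem1:
  fixes n k :: nat
    and p :: "nat \<Rightarrow> real ^ 'm::enum"
  defines "L \<equiv> (lorentz_dist_sq_map p :: real ^ 'm::enum \<Rightarrow> real ^ 'l::enum)"
    and "V \<equiv> recognition_subspace p k"
  assumes "n \<ge> 1" and "k \<ge> 1"
    and "CARD('m) = n + 1" and "CARD('l) = k + 1"
  shows
    "(k < n \<and> general_position p k \<longrightarrow>
        (A_equivalent L (definite_fold k) \<longleftrightarrow> timelike V) \<and>
        (A_equivalent L (lorentz_indefinite_fold k) \<longleftrightarrow> spacelike V) \<and>
        (A_equivalent L (\<lambda>x. vec_of (\<lambda>j. if j < k then coord x (j + 1)
            else coord x 0 * coord x 1 + (\<Sum>i = k+1..n. (coord x i)\<^sup>2))) \<longleftrightarrow> lightlike V)) \<and>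
     (k = n \<and> general_position p n \<longrightarrow>
        (A_equivalent L (definite_fold n) \<longleftrightarrow> timelike V \<or> spacelike V) \<and>
        (A_equivalent L (\<lambda>x. vec_of (\<lambda>j. if j < n then coord x (j + 1)
            else coord x 0 * coord x 1)) \<longleftrightarrow> lightlike V)) \<and>
     (n < k \<and> general_position p (n + 1) \<longrightarrow>
        A_equivalent L (\<lambda>x. vec_of (\<lambda>j. if j \<le> n then coord x j else 0)))"
proof -
  let ?N0 = "\<lambda>x :: real ^ 'm::enum. coord x 0 * coord x 1 + (\<Sum>i = k+1..<CARD('m). (coord x i)\<^sup>2)"
  note cardm = \<open>CARD('m) = n + 1\<close> and cardl = \<open>CARD('l) = k + 1\<close>
  have V_cases: "timelike V \<or> spacelike V \<or> lightlike V"
    by (auto simp: lightlike_def)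
  have V_disjoint: "\<not> (timelike V \<and> spacelike V)" "\<not> (timelike V \<and> lightlike V)"
      "\<not> (spacelike V \<and> lightlike V)"
    by (force simp: timelike_def spacelike_def lightlike_def timelike_vector_def spacelike_vector_def)+
  have definite: "A_equivalent L (definite_fold k)" if "k \<le> n" "general_position p k" "timelike V"
    using A_equivalent_of_timelike[OF cardl _ that(2)] that cardm by (simp add: L_def V_def)
  have null: "A_equivalent L (fold_map k ?N0)" if "k \<le> n" "general_position p k" "lightlike V"
    using A_equivalent_of_lightlike[OF cardl _ that(2)] that cardm by (simp add: L_def V_def)
  have not_definite_null: False
    if "k \<le> n" and D: "A_equivalent L (definite_fold k)" and N: "A_equivalent L (fold_map k ?N0)"
  proof (cases "k = n")
    case True
    then show False
      using definite_fold_no_three_point_fibre[OF cardl, where 'm='m]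
        null_fold_has_three_point_fibre[OF cardl \<open>k \<ge> 1\<close>, where 'm='m]
        A_equivalent_fibre_iff(2)[OF D] A_equivalent_fibre_iff(2)[OF N] cardm by simp
  next
    case False
    then have "k + 1 < CARD('m)"
      using that cardm by simp
    then show False
      using definite_fold_has_singleton_fibre[OF cardl, where 'm='m]
        null_fold_no_singleton_fibre[OF cardl \<open>k \<ge> 1\<close>, where 'm='m]
        A_equivalent_fibre_iff(1)[OF D] A_equivalent_fibre_iff(1)[OF N] by simp
  qed
  have part1: "(A_equivalent L (definite_fold k) \<longleftrightarrow> timelike V) \<and>
      (A_equivalent L (lorentz_indefinite_fold k) \<longleftrightarrow> spacelike V) \<and>
      (A_equivalent L (fold_map k ?N0) \<longleftrightarrow> lightlike V)"
    if "k < n" "general_position p k"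
  proof -
    have indefinite: "A_equivalent L (lorentz_indefinite_fold k)" if "spacelike V"
      using A_equivalent_of_spacelike[OF cardl _ \<open>general_position p k\<close>, of 1] that \<open>k < n\<close> cardm
      unfolding lorentz_indefinite_fold_eq_fold_map by (simp add: L_def V_def)
    have surj: "surj (lorentz_indefinite_fold k :: real ^ 'm::enum \<Rightarrow> real ^ 'l::enum)"
      using \<open>k < n\<close> cardm by (intro lorentz_indefinite_fold_surj[OF cardl]) simp
    have "\<not> surj (definite_fold k :: real ^ 'm::enum \<Rightarrow> real ^ 'l::enum)"
      by (rule definite_fold_not_surj[OF cardl])
    then have 1: False
      if "A_equivalent L (definite_fold k)" and "A_equivalent L (lorentz_indefinite_fold k)"
      using surj A_equivalent_surj_iff[OF that(1)] A_equivalent_surj_iff[OF that(2)] by simp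
    have "\<not> surj (fold_map k ?N0 :: real ^ 'm::enum \<Rightarrow> real ^ 'l::enum)"
      using \<open>k \<ge> 1\<close> by (intro not_surj_fold_map[OF cardl]) (simp add: sum_nonneg)
    then have 2: False
      if "A_equivalent L (fold_map k ?N0)" and "A_equivalent L (lorentz_indefinite_fold k)"
      using surj A_equivalent_surj_iff[OF that(1)] A_equivalent_surj_iff[OF that(2)] by simp
    have "k \<le> n"
      using that by simp
    show ?thesis
      using V_cases V_disjoint definite[OF \<open>k \<le> n\<close> that(2)] null[OF \<open>k \<le> n\<close> that(2)] indefinite 1 2
        not_definite_null[OF \<open>k \<le> n\<close>] by blast
  qed
  have part2: "(A_equivalent L (definite_fold k) \<longleftrightarrow> timelike V \<or> spacelike V) \<and>
      (A_equivalent L (fold_map k ?N0) \<longleftrightarrow> lightlike V)"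
    if "k = n" "general_position p k"
  proof -
    have space: "A_equivalent L (definite_fold k)" if "spacelike V"
      using A_equivalent_of_spacelike[OF cardl _ \<open>general_position p k\<close>, of "- 1"] that \<open>k = n\<close> cardm
      unfolding definite_fold_eq_fold_map by (simp add: L_def V_def)
    have "k \<le> n"
      using that by simp
    show ?thesis
      using V_cases V_disjoint definite[OF \<open>k \<le> n\<close> that(2)] null[OF \<open>k \<le> n\<close> that(2)] space
        not_definite_null[OF \<open>k \<le> n\<close>] by blast
  qed
  have part3: "A_equivalent L (\<lambda>x. vec_of (\<lambda>j. if j \<le> n then coord x j else 0))"
    if "n < k" "general_position p (n + 1)"
    unfolding L_def by (rule A_equivalent_inclusion[OF cardm cardl that])
  have ivl: "{k+1..<CARD('m)} = {k+1..n}"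
    using cardm by auto
  have null1: "(\<lambda>x. vec_of (\<lambda>j. if j < k then coord x (j + 1)
        else coord x 0 * coord x 1 + (\<Sum>i = k+1..n. (coord x i)\<^sup>2))) =
      (fold_map k ?N0 :: real ^ 'm::enum \<Rightarrow> real ^ 'l::enum)"
    by (intro ext) (simp only: fold_map_def ivl)
  have null2: "(\<lambda>x. vec_of (\<lambda>j. if j < n then coord x (j + 1) else coord x 0 * coord x 1)) =
      (fold_map k ?N0 :: real ^ 'm::enum \<Rightarrow> real ^ 'l::enum)" if "k = n"
    unfolding null1[symmetric] using that by (simp cong: if_cong)
  show ?thesis
  proof (intro conjI impI; elim conjE)
    assume "k < n" and "general_position p k"
    note * = part1[OF this]
    show "A_equivalent L (definite_fold k) \<longleftrightarrow> timelike V"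
      and "A_equivalent L (lorentz_indefinite_fold k) \<longleftrightarrow> spacelike V"
      using * by simp_all
    show "A_equivalent L (\<lambda>x. vec_of (\<lambda>j. if j < k then coord x (j + 1)
        else coord x 0 * coord x 1 + (\<Sum>i = k+1..n. (coord x i)\<^sup>2))) \<longleftrightarrow> lightlike V"
      unfolding null1 using * by simp
  next
    assume "k = n" and "general_position p n"
    note * = part2[OF this(1), unfolded this(1), OF this(2)]
    show "A_equivalent L (definite_fold n) \<longleftrightarrow> timelike V \<or> spacelike V"
      using * by simp
    show "A_equivalent L (\<lambda>x. vec_of (\<lambda>j. if j < n then coord x (j + 1)
        else coord x 0 * coord x 1)) \<longleftrightarrow> lightlike V"
      unfolding null2[OF \<open>k = n\<close>] using * \<open>k = n\<close> by simp
  qed (rule part3)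
qed

end
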